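(* $\mathcal{P}$ is a Polish space. $\mathcal{O}_0$ is a $\mathbf{\Delta}^0_1$ subset of $\mathcal{P}$, $\mathcal{O}_1$ is $\mathbf{\Sigma}^0_1$-complete, and $\mathcal{O}_2,\mathcal{O}_3$ are $\mathbf{\Pi}^0_2$-complete. Moreover, the set $\mathcal{O}_2^{\aleph_0}:=\{(X,f)\in\mathcal{O}_2\mid X\text{ is countable}\}$ is $\mathbf{\Pi}^1_1$-complete.
   Context: $\mathcal{K}(2^\omega)$ is the space of compact subsets of $2^\omega$ (including $\emptyset$) with the Vietoris topology. $\mathcal{H}(2^\omega)$ is the group of homeomorphisms of $2^\omega$, equipped with the Polish topology whose basic open sets are $\{f\in\mathcal{H}(2^\omega)\mid\forall 1\leq i\leq n\ f[U_i]=V_i\}$ with $n\in\omega$ and $U_i,V_i$ clopen subsets of $2^\omega$. Put $\mathcal{P}=\{(X,f)\in\mathcal{K}(2^\omega)\times\mathcal{H}(2^\omega)\mid f[X]=X\}$ with the subspace topology. For $(X,f)\in\mathcal{P}$, $f_{|X}$ is the restriction of $f$ to $X$, and for a function $g:X\to X$, $G_g=\big(\mathrm{Graph}(g)\cup\mathrm{Graph}(g)^{-1}\big)\setminus\Delta(X)$, $\Delta(X)$ being the diagonal. The continuous chromatic number $\chi_c(X,R)$ is the least cardinal $\kappa\leq\aleph_0$ for which there is a continuous map $c:X\to\kappa$ ($\kappa$ discrete) with $c(x)\neq c(y)$ whenever $(x,y)\in R$, if it exists, and $2^{\aleph_0}$ otherwise. For $\kappa\in\{0,1,2,3\}$, $\mathcal{O}_\kappa=\{(X,f)\in\mathcal{P}\mid\chi_c(X,G_{f_{|X}})>\kappa\}$.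 $\mathbf{\Delta}^0_1$, $\mathbf{\Sigma}^0_1$, $\mathbf{\Pi}^0_2$, $\mathbf{\Pi}^1_1$ are the classes of clopen, open, $G_\delta$, co-analytic sets. A subset of $\mathcal{P}$ (which is zero-dimensional) is $\Gamma$-complete if it is in $\Gamma$ and every $\Gamma$ subset of a zero-dimensional Polish space is the preimage of it under a continuous map. *)

theory Defs
  imports "HOL-Analysis.Analysis" "HOL-Library.Extended_Nat"
begin

section \<open>Polish spaces, descriptive classes and completeness\<close>

definition polish :: "'a topology \<Rightarrow> bool" where
  "polish X \<longleftrightarrow> separable_space X \<and> completely_metrizable_space X"

definition zero_dimensional :: "'a topology \<Rightarrow> bool" where
  "zero_dimensional X \<longleftrightarrow> neighbourhood_base_of (\<lambda>U. openin X U \<and> closedin X U) X"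

definition clopen_in :: "'a topology \<Rightarrow> 'a set \<Rightarrow> bool" where
  "clopen_in X A \<longleftrightarrow> openin X A \<and> closedin X A"

text \<open>Analytic sets are the projections along the Baire space of closed sets; \<open>nat \<Rightarrow> nat\<close> carries
  the product of the discrete topologies.\<close>

definition analytic_in :: "'a topology \<Rightarrow> 'a set \<Rightarrow> bool" where
  "analytic_in X A \<longleftrightarrow>
     (\<exists>F. closedin (prod_topology X (euclidean :: (nat \<Rightarrow> nat) topology)) F \<and> A = fst ` F)"

definition coanalytic_in :: "'a topology \<Rightarrow> 'a set \<Rightarrow> bool" where
  "coanalytic_in X A \<longleftrightarrow> A \<subseteq> topspace X \<and> analytic_in X (topspace X - A)"

text \<open>A descriptive class lives on all spaces at once. As HOL has no polymorphic arguments, it is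
  passed below as its two instances, on the points of \<open>X\<close> and on those of the test spaces \<open>Z\<close>. In
  the named notions of completeness, the type \<open>'z\<close> of the points of the test spaces is a parameter;
  a theorem that leaves it as a type variable speaks about all test spaces.\<close>

definition class_complete ::
  "('a topology \<Rightarrow> 'a set \<Rightarrow> bool) \<Rightarrow> ('z topology \<Rightarrow> 'z set \<Rightarrow> bool) \<Rightarrow> 'a topology \<Rightarrow> 'a set \<Rightarrow> bool"
  where
  "class_complete \<Gamma> \<Gamma>' X A \<longleftrightarrow>
     \<Gamma> X A \<and>
     (\<forall>Z C. polish Z \<and> zero_dimensional Z \<and> \<Gamma>' Z C \<longrightarrow>
        (\<exists>f. continuous_map Z X f \<and> C = {z \<in> topspace Z. f z \<in> A}))"

definition Sigma01_complete :: "'z itself \<Rightarrow> 'a topology \<Rightarrow> 'a set \<Rightarrow> bool" where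
  "Sigma01_complete (_ :: 'z itself) = class_complete openin (openin :: 'z topology \<Rightarrow> _)"

definition Pi02_complete :: "'z itself \<Rightarrow> 'a topology \<Rightarrow> 'a set \<Rightarrow> bool" where
  "Pi02_complete (_ :: 'z itself) = class_complete gdelta_in (gdelta_in :: 'z topology \<Rightarrow> _)"

definition Pi11_complete :: "'z itself \<Rightarrow> 'a topology \<Rightarrow> 'a set \<Rightarrow> bool" where
  "Pi11_complete (_ :: 'z itself) = class_complete coanalytic_in (coanalytic_in :: 'z topology \<Rightarrow> _)"


section \<open>The continuous chromatic number\<close>

text \<open>The possible values: \<open>Countable_card \<kappa>\<close> is the cardinal \<open>\<kappa> \<le> \<aleph>\<^sub>0\<close>, with \<open>\<aleph>\<^sub>0 = \<infinity>\<close>, and \<open>Continuum\<close>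
  is \<open>2\<close> to the power \<open>\<aleph>\<^sub>0\<close>.\<close>

datatype chromatic_card = Countable_card enat | Continuum

instantiation chromatic_card :: linorder
begin

fun less_eq_chromatic_card :: "chromatic_card \<Rightarrow> chromatic_card \<Rightarrow> bool" where
  "Countable_card \<kappa> \<le> Countable_card \<mu> \<longleftrightarrow> \<kappa> \<le> \<mu>"
| "Continuum \<le> Countable_card \<mu> \<longleftrightarrow> False"
| "\<kappa> \<le> Continuum \<longleftrightarrow> True"

definition less_chromatic_card :: "chromatic_card \<Rightarrow> chromatic_card \<Rightarrow> bool" where
  "(\<kappa> :: chromatic_card) < \<mu> \<longleftrightarrow> \<kappa> \<le> \<mu> \<and> \<not> \<mu> \<le> \<kappa>"

instance
proof
  fix x y z :: chromatic_card
  show "x < y \<longleftrightarrow> x \<le> y \<and> \<not> y \<le> x" by (rule less_chromatic_card_def)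
  show "x \<le> x" by (cases x) auto
  show "x \<le> y \<Longrightarrow> y \<le> z \<Longrightarrow> x \<le> z" by (cases x; cases y; cases z) auto
  show "x \<le> y \<Longrightarrow> y \<le> x \<Longrightarrow> x = y" by (cases x; cases y) auto
  show "x \<le> y \<or> y \<le> x" by (cases x; cases y) auto
qed

end

text \<open>The set of colours is the von Neumann cardinal \<open>\<kappa>\<close>, which is all of \<open>nat\<close> for \<open>\<kappa> = \<infinity>\<close>.\<close>

definition continuously_colourable :: "'a topology \<Rightarrow> ('a \<times> 'a) set \<Rightarrow> enat \<Rightarrow> bool" where
  "continuously_colourable X R \<kappa> \<longleftrightarrow>
     (\<exists>c. continuous_map X (discrete_topology {n. enat n < \<kappa>}) c \<and> (\<forall>(x, y) \<in> R. c x \<noteq> c y))"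

definition chi_c :: "'a topology \<Rightarrow> ('a \<times> 'a) set \<Rightarrow> chromatic_card" where
  "chi_c X R =
     (if \<exists>\<kappa>. continuously_colourable X R \<kappa>
      then Countable_card (LEAST \<kappa>. continuously_colourable X R \<kappa>)
      else Continuum)"

definition graph_on :: "'a set \<Rightarrow> ('a \<Rightarrow> 'a) \<Rightarrow> ('a \<times> 'a) set" where
  "graph_on X g = {(x, g x) | x. x \<in> X}"

definition G_graph :: "'a set \<Rightarrow> ('a \<Rightarrow> 'a) \<Rightarrow> ('a \<times> 'a) set" where
  "G_graph X g = (graph_on X g \<union> (graph_on X g)\<inverse>) - Id_on X"


section \<open>Compact sets and homeomorphisms of the Cantor space\<close>

text \<open>The type \<open>nat \<Rightarrow> bool\<close> carries the product of the discrete topologies.\<close>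

type_synonym cantor = "nat \<Rightarrow> bool"

definition vietoris :: "cantor set topology" where
  "vietoris = topology_generated_by
     ({{K. compact K \<and> K \<subseteq> U} | U. open U} \<union> {{K. compact K \<and> K \<inter> U \<noteq> {}} | U. open U})"

definition homeos :: "(cantor \<Rightarrow> cantor) set" where
  "homeos = {f. homeomorphic_map euclidean euclidean f}"

definition homeo_topology :: "(cantor \<Rightarrow> cantor) topology" where
  "homeo_topology = topology_generated_by
     {{f \<in> homeos. \<forall>i \<in> {1..n}. f ` U i = V i} | (n :: nat) U V.
        \<forall>i \<in> {1..n}. clopen_in euclidean (U i) \<and> clopen_in euclidean (V i)}"

definition P_set :: "(cantor set \<times> (cantor \<Rightarrow> cantor)) set" where
  "P_set = {(X, f). compact X \<and> f \<in> homeos \<and> f ` X = X}"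

definition P_space :: "(cantor set \<times> (cantor \<Rightarrow> cantor)) topology" where
  "P_space = subtopology (prod_topology vietoris homeo_topology) P_set"

definition O_set :: "nat \<Rightarrow> (cantor set \<times> (cantor \<Rightarrow> cantor)) set" where
  "O_set \<kappa> = {(X, f) \<in> P_set.
     chi_c (top_of_set X) (G_graph X (restrict f X)) > Countable_card (enat \<kappa>)}"

definition O_countable :: "(cantor set \<times> (cantor \<Rightarrow> cantor)) set" where
  "O_countable = {(X, f) \<in> O_set 2. countable X}"

lemma topspace_vietoris: "topspace vietoris = {K. compact K}"
  by (auto simp: vietoris_def topology_generated_by_topspace)

lemma topspace_homeo_topology: "topspace homeo_topology = homeos"
proof -
  have "homeos \<in> {{f \<in> homeos. \<forall>i \<in> {1..n}. f ` U i = V i} | (n :: nat) U V.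
        \<forall>i \<in> {1..n}. clopen_in euclidean (U i) \<and> clopen_in euclidean (V i)}"
    by (rule CollectI, rule exI[of _ 0]) auto
  then show ?thesis
    unfolding homeo_topology_def topology_generated_by_topspace by blast
qed

lemma topspace_P_space: "topspace P_space = P_set"
  by (auto simp: P_space_def topspace_vietoris topspace_homeo_topology P_set_def)

end

theory Submission
  imports Defs
begin

text \<open>
  Write \<open>seg m x\<close> for the first \<open>m\<close> digits of \<open>x\<close>. By compactness of the Cantor space, a
  neighbourhood of a pair \<open>(X, f)\<close> is given by finite data: for some \<open>m\<close>, the set of initial segments
  \<open>seg m ` X\<close> and the two locally constant functions \<open>seg m \<circ> f\<close> and \<open>seg m \<circ> inv f\<close>
  (\<open>openin_P_space_iff\<close>). This level-\<open>m\<close> datum ranges over a countable set, and a coherent sequence of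
  data comes from a pair: the first components are the levels of a tree without dead ends, and the
  other two define uniform limits of homeomorphisms and of their inverses, which are again inverse to
  each other. So the space of pairs is a closed subset of a countable product of discrete sets, hence
  Polish (\<open>polish_if_levels\<close>).

  A continuous colouring of a compact \<open>X\<close> extends to a locally constant function on the Cantor space,
  and there are only countably many of these with finitely many colours. That a fixed one has a
  monochromatic edge is an open condition on \<open>(X, f)\<close>, so for \<open>k > 0\<close> the set \<open>O_set k\<close> is a countable
  intersection of open sets (\<open>O_set_eq\<close>). For \<open>k = 1\<close> there is a single colouring, and \<open>O_set 0\<close> says that \<open>X\<close> is nonempty.

  All lower bounds come from one family of involutions. For \<open>\<alpha> :: nat \<Rightarrow> bool\<close>, the map \<open>flip \<alpha>\<close>
  negates the digit behind the first \<open>True\<close> of a sequence if \<open>\<alpha>\<close> holds at the position of that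
  \<open>True\<close>. It moves a point iff \<open>\<alpha>\<close> is not identically false. If \<open>\<alpha>\<close> holds only finitely often, two
  colours suffice: use the negated digit. If it holds infinitely often, there are edges whose two ends
  converge to the fixed point \<open>\<lambda>_. False\<close>, so that no continuous colouring exists at all. Hence
  \<open>\<alpha> \<mapsto> (UNIV, flip \<alpha>)\<close> reduces "somewhere true" to \<open>O_set 1\<close>, and "infinitely often true" to both
  \<open>O_set 2\<close> and \<open>O_set 3\<close>; every open, respectively \<open>G\<^sub>\<delta>\<close>, subset of a zero-dimensional Polish space
  reduces to these conditions.

  For the last claim, \<open>X\<close> is uncountable iff some splitting scheme of initial segments lives in it. This
  is an existential statement over the Baire space with a closed matrix, whence countability is
  co-analytic (\<open>coanalytic_in_O_countable\<close>). For hardness, take \<open>f = flip (\<lambda>_. True)\<close>, and let \<open>X\<close> be the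
  set of all sequences for which the word spelt by the positions of their digits \<open>True\<close>, except the first
  such position and the one right behind it, stays inside a given tree \<open>T\<close> on \<open>nat\<close>. The exception makes \<open>X\<close>
  invariant and lets it contain all the short edges, so that no finite number of colours ever suffices
  for \<open>(X, f)\<close>. Every letter has infinitely many codes, and a code carries a free bit, so a branch of
  \<open>T\<close> is spelt by uncountably many points of \<open>X\<close>; without branches, all points of \<open>X\<close> have finite support
  (\<open>uncountable_coded_body\<close>, \<open>countable_coded_body\<close>). A co-analytic set is the set of points over which
  a continuously varying tree is well-founded.
\<close>

section \<open>Initial segments and compactness of the Cantor space\<close>

definition seg :: "nat \<Rightarrow> (nat \<Rightarrow> 'a) \<Rightarrow> 'a list" where
  "seg n x = map x [0..<n]"

lemma length_seg [simp]: "length (seg n x) = n"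
  by (simp add: seg_def)

lemma seg_0 [simp]: "seg 0 x = []"
  by (simp add: seg_def)

lemma seg_eq_iff: "seg n x = seg n y \<longleftrightarrow> (\<forall>i<n. x i = y i)"
  by (auto simp: seg_def)

lemma seg_eq_mono: "seg n x = seg n y \<Longrightarrow> m \<le> n \<Longrightarrow> seg m x = seg m y"
  by (auto simp: seg_eq_iff)

lemma take_seg: "m \<le> n \<Longrightarrow> take m (seg n x) = seg m x"
  by (simp add: seg_def take_map)

lemma ext_seg: "(\<And>n. seg n x = seg n y) \<Longrightarrow> x = y"
  by (auto simp: seg_eq_iff fun_eq_iff)

lemma seg_pad: "seg (length s) (\<lambda>i. i < length s \<and> s ! i) = s"
  by (auto simp: seg_def intro: nth_equalityI)

lemma finite_bool_lists: "finite {s :: bool list. length s = n}"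
  using finite_lists_length_eq[of "UNIV :: bool set" n] by simp

lemma open_seg: "open {y :: nat \<Rightarrow> 'a::discrete_topology. seg n y = s}"
proof (cases "length s = n")
  case True
  have "{y. seg n y = s} = (\<Inter>i<n. (\<lambda>y. y i) -` {s ! i})"
    using True by (auto simp: seg_def list_eq_iff_nth_eq)
  moreover have "open ((\<lambda>y :: nat \<Rightarrow> 'a. y i) -` {s ! i})" for i
    by (intro open_vimage open_discrete continuous_on_product_coordinates)
  ultimately show ?thesis
    by auto
next
  case False
  then have "{y. seg n y = s} = {}"
    by auto
  then show ?thesis
    by simp
qed

text \<open>The type only carries the product topology of discrete factors, for the Cantor and the Baire space
  alike; from here on openness is used in this combinatorial form.\<close>

lemma open_iff_seg:
  fixes U :: "(nat \<Rightarrow> 'a::discrete_topology) set"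
  shows "open U \<longleftrightarrow> (\<forall>x\<in>U. \<exists>n. \<forall>y. seg n y = seg n x \<longrightarrow> y \<in> U)"
proof
  assume "open U"
  show "\<forall>x\<in>U. \<exists>n. \<forall>y. seg n y = seg n x \<longrightarrow> y \<in> U"
  proof
    fix x assume "x \<in> U"
    obtain X where X: "x \<in> (\<Pi>\<^sub>E i\<in>UNIV. X i)" "finite {i. X i \<noteq> (UNIV :: 'a set)}"
        "(\<Pi>\<^sub>E i\<in>UNIV. X i) \<subseteq> U"
      using product_topology_open_contains_basis[of "\<lambda>_. euclidean" UNIV U x] \<open>open U\<close> \<open>x \<in> U\<close>
      by (auto simp: open_fun_def)
    obtain n where n: "\<And>i. X i \<noteq> UNIV \<Longrightarrow> i < n"
      using X(2) by (metis (mono_tags, lifting) finite_nat_set_iff_bounded mem_Collect_eq)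
    have "y \<in> U" if "seg n y = seg n x" for y
    proof -
      have "y i \<in> X i" for i
        using that n[of i] X(1) by (cases "X i = UNIV") (auto simp: seg_eq_iff PiE_iff)
      then show ?thesis
        using X(3) by (auto simp: PiE_iff)
    qed
    then show "\<exists>n. \<forall>y. seg n y = seg n x \<longrightarrow> y \<in> U"
      by blast
  qed
next
  assume *: "\<forall>x\<in>U. \<exists>n. \<forall>y. seg n y = seg n x \<longrightarrow> y \<in> U"
  show "open U"
  proof (subst open_subopen, intro ballI)
    fix x assume "x \<in> U"
    then obtain n where "\<forall>y. seg n y = seg n x \<longrightarrow> y \<in> U"
      using * by blast
    then show "\<exists>T. open T \<and> x \<in> T \<and> T \<subseteq> U"
      by (intro exI[of _ "{y. seg n y = seg n x}"]) (auto simp: open_seg)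
  qed
qed

lemma compact_cantor: "compact (UNIV :: cantor set)"
proof -
  have "compact (UNIV :: bool set)"
    by (simp add: finite_imp_compact)
  then have "compact_space (product_topology (\<lambda>_::nat. euclidean :: bool topology) UNIV)"
    unfolding compact_space_product_topology by (simp add: compact_space_def compactin_euclidean_iff)
  then show ?thesis
    by (simp add: euclidean_product_topology compact_space_def compactin_euclidean_iff)
qed

text \<open>Compactness in the form of the fan theorem. The bar is a property of segments that passes to
  the longer segments of the same sequence.\<close>

lemma fan:
  fixes X :: "cantor set"
  assumes "compact X"
    and bar: "\<And>x. x \<in> X \<Longrightarrow> \<exists>n. Q (seg n x)"
    and mono: "\<And>x m n. Q (seg m x) \<Longrightarrow> m \<le> n \<Longrightarrow> Q (seg n x)"
  shows "\<exists>n. \<forall>x\<in>X. Q (seg n x)"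
proof -
  define N where "N x = (SOME n. Q (seg n x))" for x
  have N: "Q (seg (N x) x)" if "x \<in> X" for x
    unfolding N_def using bar[OF that] by (rule someI_ex)
  have "X \<subseteq> (\<Union>x\<in>X. {y. seg (N x) y = seg (N x) x})"
    by blast
  then obtain D where D: "D \<subseteq> X" "finite D" "X \<subseteq> (\<Union>x\<in>D. {y. seg (N x) y = seg (N x) x})"
    by (rule compactE_image[of X X "\<lambda>x. {y. seg (N x) y = seg (N x) x}",
          OF \<open>compact X\<close> open_seg])
  define n where "n = Max (N ` D)"
  have n: "N x \<le> n" if "x \<in> D" for x
    unfolding n_def using D(2) that by simp
  have "Q (seg n y)" if y: "y \<in> X" for y
  proof -
    obtain x where "x \<in> D" "seg (N x) y = seg (N x) x"
      using D(3) y by blast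
    moreover have "Q (seg (N x) x)"
      using N D(1) \<open>x \<in> D\<close> by blast
    ultimately have "Q (seg (N x) y)"
      by simp
    then show ?thesis
      by (rule mono) (rule n[OF \<open>x \<in> D\<close>])
  qed
  then show ?thesis
    by blast
qed

text \<open>For the direction from left to right, the fan theorem is applied to the bar of those initial
  segments of points of \<open>X\<close> that already differ from a given point outside \<open>X\<close>.\<close>

lemma compact_iff_closed_cantor: "compact (X :: cantor set) \<longleftrightarrow> closed X"
proof
  assume "closed X"
  then show "compact X"
    using compact_Int_closed[OF compact_cantor, of X] by simp
next
  assume "compact X"
  have "\<exists>n. \<forall>z. seg n z = seg n y \<longrightarrow> z \<in> - X" if "y \<notin> X" for y
  proof -
    have "\<exists>n. \<forall>x\<in>X. seg (length (seg n x)) y \<noteq> seg n x"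
    proof (rule fan[OF \<open>compact X\<close>])
      fix x assume "x \<in> X"
      then show "\<exists>n. seg (length (seg n x)) y \<noteq> seg n x"
        using that ext_seg[of y x] by auto
    next
      fix x and m n :: nat
      assume "seg (length (seg m x)) y \<noteq> seg m x" "m \<le> n"
      then show "seg (length (seg n x)) y \<noteq> seg n x"
        using seg_eq_mono[of n y x m] unfolding length_seg by blast
    qed
    then obtain n where "\<forall>x\<in>X. seg n y \<noteq> seg n x"
      by auto
    then have "\<forall>z. seg n z = seg n y \<longrightarrow> z \<in> - X"
      by (metis ComplI)
    then show ?thesis ..
  qed
  then show "closed X"
    unfolding closed_def open_iff_seg by blast
qed

definition locally_constant :: "(cantor \<Rightarrow> 'd) set" where
  "locally_constant = {c. \<exists>n. \<forall>x y. seg n x = seg n y \<longrightarrow> c x = c y}"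

text \<open>Pointwise local constancy gives a uniform modulus by the fan theorem, with the bar of all segments
  on whose cylinder \<open>c\<close> is constant.\<close>

lemma locally_constantI:
  assumes "\<And>x. \<exists>n. \<forall>y. seg n y = seg n x \<longrightarrow> c y = c x"
  shows "c \<in> locally_constant"
proof -
  define Q where "Q s \<longleftrightarrow> (\<forall>y z. seg (length s) y = s \<longrightarrow> seg (length s) z = s \<longrightarrow> c y = c z)" for s
  have "\<exists>n. \<forall>x\<in>UNIV. Q (seg n x)"
  proof (rule fan[OF compact_cantor])
    fix x
    obtain n where n: "\<forall>y. seg n y = seg n x \<longrightarrow> c y = c x"
      using assms[of x] by blast
    have "c y = c z" if "seg n y = seg n x" "seg n z = seg n x" for y z
      using n that by metis
    then show "\<exists>n. Q (seg n x)"
      unfolding Q_def length_seg by blast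
  next
    fix x and m n :: nat
    assume "Q (seg m x)" "m \<le> n"
    then show "Q (seg n x)"
      unfolding Q_def length_seg using seg_eq_mono by blast
  qed
  then obtain n where "Q (seg n x)" for x
    by blast
  then have "c x = c y" if "seg n x = seg n y" for x y
    using that unfolding Q_def length_seg by blast
  then show ?thesis
    unfolding locally_constant_def by blast
qed

lemma locally_constant_compose: "c \<in> locally_constant \<Longrightarrow> g \<circ> c \<in> locally_constant"
  unfolding locally_constant_def comp_def mem_Collect_eq by metis

lemma continuous_seg_locally_constant:
  fixes f :: "cantor \<Rightarrow> cantor"
  assumes "continuous_on UNIV f"
  shows "seg m \<circ> f \<in> locally_constant"
proof (rule locally_constantI)
  fix x
  have "open (f -` {y. seg m y = seg m (f x)})"
    by (intro open_vimage open_seg assms)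
  then show "\<exists>n. \<forall>y. seg n y = seg n x \<longrightarrow> (seg m \<circ> f) y = (seg m \<circ> f) x"
    unfolding open_iff_seg by (auto simp: vimage_def)
qed

lemma continuous_if_seg_locally_constant:
  fixes f :: "cantor \<Rightarrow> cantor"
  assumes "\<And>m. seg m \<circ> f \<in> locally_constant"
  shows "continuous_on UNIV f"
proof -
  have "open (f -` U)" if U: "open U" for U
    unfolding open_iff_seg
  proof
    fix x assume "x \<in> f -` U"
    then obtain m where m: "\<And>y. seg m y = seg m (f x) \<Longrightarrow> y \<in> U"
      using U unfolding open_iff_seg vimage_def by blast
    obtain n where "\<And>y z. seg n y = seg n z \<Longrightarrow> seg m (f y) = seg m (f z)"
      using assms[of m] by (auto simp: locally_constant_def)
    then show "\<exists>n. \<forall>y. seg n y = seg n x \<longrightarrow> y \<in> f -` U"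
      using m by (metis vimageI2)
  qed
  then show ?thesis
    by (simp add: continuous_on_open_vimage)
qed

lemma clopen_iff_locally_constant:
  "clopen_in euclidean (A :: cantor set) \<longleftrightarrow> (\<lambda>x. x \<in> A) \<in> locally_constant"
proof
  assume "clopen_in euclidean A"
  then have "open A" "open (- A)"
    by (auto simp: clopen_in_def open_Compl)
  then have "\<exists>n. \<forall>y. seg n y = seg n x \<longrightarrow> (y \<in> A) = (x \<in> A)" for x
    unfolding open_iff_seg by (cases "x \<in> A") auto
  then show "(\<lambda>x. x \<in> A) \<in> locally_constant"
    by (rule locally_constantI)
next
  assume "(\<lambda>x. x \<in> A) \<in> locally_constant"
  then obtain n where "\<And>x y. seg n x = seg n y \<Longrightarrow> (x \<in> A) = (y \<in> A)"
    by (auto simp: locally_constant_def)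
  then have "open A" "open (- A)"
    unfolding open_iff_seg by (metis, metis ComplD ComplI)
  then show "clopen_in euclidean A"
    by (simp add: clopen_in_def closed_def)
qed

text \<open>By its uniform modulus, such a function is a finite table indexed by the segments of one length.\<close>

lemma countable_locally_constant: "countable (locally_constant :: (cantor \<Rightarrow> 'd::countable) set)"
proof -
  let ?G = "\<Union>n. (\<lambda>g x. g (seg n x)) ` (\<Pi>\<^sub>E s\<in>{s :: bool list. length s = n}. (UNIV :: 'd set))"
  have "countable ?G"
    by (intro countable_UN countable_image countable_PiE finite_bool_lists) auto
  moreover have "locally_constant \<subseteq> ?G"
  proof
    fix c :: "cantor \<Rightarrow> 'd" assume "c \<in> locally_constant"
    then obtain n where n: "\<And>x y. seg n x = seg n y \<Longrightarrow> c x = c y"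
      by (auto simp: locally_constant_def)
    let ?g = "\<lambda>s\<in>{s :: bool list. length s = n}. c (\<lambda>i. i < n \<and> s ! i)"
    have "c = (\<lambda>x. ?g (seg n x))"
      by (rule ext, simp, rule n) (metis length_seg seg_pad)
    moreover have "?g \<in> (\<Pi>\<^sub>E s\<in>{s :: bool list. length s = n}. UNIV)"
      by auto
    ultimately show "c \<in> ?G"
      by blast
  qed
  ultimately show ?thesis
    by (rule countable_subset[rotated])
qed

section \<open>The topology of the space of pairs\<close>

text \<open>The inverse is recorded as well: uniform convergence of homeomorphisms alone would not make the
  limit injective.\<close>

definition level :: "nat \<Rightarrow> cantor set \<times> (cantor \<Rightarrow> cantor) \<Rightarrow>
    bool list set \<times> (cantor \<Rightarrow> bool list) \<times> (cantor \<Rightarrow> bool list)" where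
  "level m p = (seg m ` fst p, seg m \<circ> snd p, seg m \<circ> inv (snd p))"

lemma level_eq_iff: "level m p = level m q \<longleftrightarrow>
    seg m ` fst p = seg m ` fst q \<and> (\<forall>x. seg m (snd p x) = seg m (snd q x)) \<and>
    (\<forall>x. seg m (inv (snd p) x) = seg m (inv (snd q) x))"
  by (simp add: level_def fun_eq_iff)

lemma seg_image_eq_mono:
  assumes "seg n ` X = seg n ` Y" "m \<le> n"
  shows "seg m ` X = seg m ` Y"
proof -
  have "seg m ` Z = take m ` seg n ` Z" for Z :: "(nat \<Rightarrow> 'a) set"
    using assms(2) by (simp add: image_image take_seg)
  then show ?thesis
    using assms(1) by simp
qed

lemma level_eq_mono: "level n p = level n q \<Longrightarrow> m \<le> n \<Longrightarrow> level m p = level m q"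
  unfolding level_eq_iff using seg_eq_mono seg_image_eq_mono by blast

lemma homeosI:
  assumes "continuous_on UNIV f" "continuous_on UNIV g" "\<And>x. g (f x) = x" "\<And>x. f (g x) = x"
  shows "f \<in> homeos" "inv f = g"
proof -
  have "homeomorphic_maps euclidean euclidean f g"
    using assms by (simp add: homeomorphic_maps_def)
  then show "f \<in> homeos"
    unfolding homeos_def mem_Collect_eq homeomorphic_map_maps by blast
  show "inv f = g"
    using assms(3,4) by (intro inv_equality) auto
qed

lemma homeosD:
  assumes "f \<in> homeos"
  shows "continuous_on UNIV f" "continuous_on UNIV (inv f)" "bij f"
    "inv f (f x) = x" "f (inv f x) = x"
proof -
  obtain g where "homeomorphic_maps euclidean euclidean f g"
    using assms unfolding homeos_def mem_Collect_eq homeomorphic_map_maps by blast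
  then have g: "continuous_on UNIV f" "continuous_on UNIV g" "\<And>x. g (f x) = x" "\<And>x. f (g x) = x"
    by (simp_all add: homeomorphic_maps_def)
  then show "continuous_on UNIV f" "continuous_on UNIV (inv f)" "inv f (f x) = x" "f (inv f x) = x"
    using homeosI(2)[OF g] by simp_all
  show "bij f"
    using g(3,4) by (metis bijI')
qed

lemma P_setD:
  assumes "p \<in> P_set"
  shows "compact (fst p)" "snd p \<in> homeos" "snd p ` fst p = fst p"
  using assms by (auto simp: P_set_def)

text \<open>By induction on the generation of the open set. An intersection uses the larger of two levels,
  which is possible because higher levels determine the lower ones.\<close>

lemma generated_levels:
  assumes "openin (topology_generated_by \<S>) A" "x \<in> A"
    and basis: "\<And>G x. G \<in> \<S> \<Longrightarrow> x \<in> G \<Longrightarrow> \<exists>m. \<forall>y\<in>T. lev m y = lev m x \<longrightarrow> y \<in> G"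
    and mono: "\<And>m n x y. lev n x = lev n y \<Longrightarrow> m \<le> n \<Longrightarrow> lev m x = lev m y"
  shows "\<exists>m::nat. \<forall>y\<in>T. lev m y = lev m x \<longrightarrow> y \<in> A"
  using openin_topology_generated_by[OF assms(1)] \<open>x \<in> A\<close>
proof (induction arbitrary: x)
  case (Int A B)
  then obtain a b where "\<forall>y\<in>T. lev a y = lev a x \<longrightarrow> y \<in> A" "\<forall>y\<in>T. lev b y = lev b x \<longrightarrow> y \<in> B"
    by (meson IntD1 IntD2)
  then have "\<forall>y\<in>T. lev (max a b) y = lev (max a b) x \<longrightarrow> y \<in> A \<inter> B"
    using mono[OF _ max.cobounded1] mono[OF _ max.cobounded2] by blast
  then show ?case ..
next
  case (UN K)
  then obtain k where k: "k \<in> K" "x \<in> k"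
    by blast
  from UN.IH[OF this] show ?case
    using k(1) by blast
qed (use basis in auto)

text \<open>For the generators that demand \<open>K \<subseteq> U\<close>, the fan theorem finds a level at which the
  cylinders through points of \<open>X\<close> are all contained in \<open>U\<close>.\<close>

lemma vietoris_levels:
  assumes "openin vietoris A" "X \<in> A"
  shows "\<exists>m. \<forall>Y. compact Y \<and> seg m ` Y = seg m ` X \<longrightarrow> Y \<in> A"
proof -
  have "\<exists>m. \<forall>Y\<in>Collect compact. seg m ` Y = seg m ` X \<longrightarrow> Y \<in> A"
  proof (rule generated_levels[OF assms[unfolded vietoris_def]])
    fix G :: "cantor set set" and X
    assume G: "G \<in> {{K. compact K \<and> K \<subseteq> U} |U. open U} \<union> {{K. compact K \<and> K \<inter> U \<noteq> {}} |U. open U}"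
      and X: "X \<in> G"
    from G consider U where "open U" "G = {K. compact K \<and> K \<subseteq> U}"
      | U where "open U" "G = {K. compact K \<and> K \<inter> U \<noteq> {}}"
      by blast
    then show "\<exists>m. \<forall>Y\<in>Collect compact. seg m ` Y = seg m ` X \<longrightarrow> Y \<in> G"
    proof cases
      case 1
      have "\<exists>n. \<forall>x\<in>X. \<forall>y. seg (length (seg n x)) y = seg n x \<longrightarrow> y \<in> U"
      proof (rule fan)
        fix x assume "x \<in> X"
        then have "x \<in> U"
          using X 1(2) by blast
        then show "\<exists>n. \<forall>y. seg (length (seg n x)) y = seg n x \<longrightarrow> y \<in> U"
          using \<open>open U\<close> unfolding open_iff_seg length_seg by blast
      next
        fix x and m n :: nat
        assume "\<forall>y. seg (length (seg m x)) y = seg m x \<longrightarrow> y \<in> U" "m \<le> n"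
        then show "\<forall>y. seg (length (seg n x)) y = seg n x \<longrightarrow> y \<in> U"
          unfolding length_seg using seg_eq_mono by blast
      qed (use X 1(2) in blast)
      then obtain n where n: "\<forall>x\<in>X. \<forall>y. seg n y = seg n x \<longrightarrow> y \<in> U"
        unfolding length_seg by blast
      have "Y \<subseteq> U" if "seg n ` Y = seg n ` X" for Y
      proof
        fix y assume "y \<in> Y"
        then have "seg n y \<in> seg n ` X"
          using that by blast
        then show "y \<in> U"
          using n by blast
      qed
      then show ?thesis
        unfolding 1(2) by blast
    next
      case 2
      obtain x where x: "x \<in> X" "x \<in> U"
        using X 2(2) by blast
      then obtain n where n: "\<forall>y. seg n y = seg n x \<longrightarrow> y \<in> U"
        using \<open>open U\<close> unfolding open_iff_seg by blast
      have "Y \<inter> U \<noteq> {}" if "seg n ` Y = seg n ` X" for Y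
      proof -
        have "seg n x \<in> seg n ` Y"
          using that x(1) by blast
        then show ?thesis
          using n by force
      qed
      then show ?thesis
        unfolding 2(2) by blast
    qed
  qed (rule seg_image_eq_mono)
  then show ?thesis
    by blast
qed

text \<open>The image \<open>f ` U\<close> is the preimage of \<open>U\<close> under \<open>inv f\<close>; a clopen \<open>U\<close> depends on finitely many
  digits, so finitely many digits of the values of \<open>inv f\<close> determine it.\<close>

lemma homeo_levels:
  assumes "openin homeo_topology A" "f \<in> A"
  shows "\<exists>m. \<forall>g\<in>homeos. (\<forall>x. seg m (inv g x) = seg m (inv f x)) \<longrightarrow> g \<in> A"
proof -
  have "\<exists>m. \<forall>g\<in>homeos. seg m \<circ> inv g = seg m \<circ> inv f \<longrightarrow> g \<in> A"
  proof (rule generated_levels[OF assms[unfolded homeo_topology_def]])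
    fix G f
    assume G: "G \<in> {{f \<in> homeos. \<forall>i \<in> {1..n}. f ` U i = V i} | (n :: nat) U V.
        \<forall>i \<in> {1..n}. clopen_in euclidean (U i) \<and> clopen_in euclidean (V i)}" and "f \<in> G"
    then obtain n :: nat and U V where nUV: "G = {f \<in> homeos. \<forall>i \<in> {1..n}. f ` U i = V i}"
        "\<And>i. i \<in> {1..n} \<Longrightarrow> clopen_in euclidean (U i)"
      by blast
    have f: "f \<in> homeos" "\<And>i. i \<in> {1..n} \<Longrightarrow> f ` U i = V i"
      using \<open>f \<in> G\<close> nUV(1) by auto
    have "\<exists>m. \<forall>x y. seg m x = seg m y \<longrightarrow> (x \<in> U i) = (y \<in> U i)" if "i \<in> {1..n}" for i
      using nUV(2)[OF that] unfolding clopen_iff_locally_constant locally_constant_def by blast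
    then obtain N where N: "\<And>i x y. i \<in> {1..n} \<Longrightarrow> seg (N i) x = seg (N i) y \<Longrightarrow> (x \<in> U i) = (y \<in> U i)"
      by metis
    define m where "m = Max (N ` {1..n})"
    have m: "N i \<le> m" if "i \<in> {1..n}" for i
      unfolding m_def using that by simp
    have "g \<in> G" if g: "g \<in> homeos" and eq: "seg m \<circ> inv g = seg m \<circ> inv f" for g
    proof -
      have "g ` U i = V i" if i: "i \<in> {1..n}" for i
      proof -
        have "g ` U i = inv g -` U i" "f ` U i = inv f -` U i"
          using homeosD(3)[OF g] homeosD(3)[OF f(1)] by (simp_all add: bij_vimage_eq_inv_image bij_imp_bij_inv inv_inv_eq)
        moreover have "(inv g y \<in> U i) = (inv f y \<in> U i)" for y
          by (rule N[OF i], rule seg_eq_mono[OF _ m[OF i]]) (use eq in \<open>simp add: fun_eq_iff\<close>)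
        ultimately show ?thesis
          using f(2)[OF i] by auto
      qed
      then show ?thesis
        using g nUV(1) by blast
    qed
    then show "\<exists>m. \<forall>g\<in>homeos. seg m \<circ> inv g = seg m \<circ> inv f \<longrightarrow> g \<in> G"
      by blast
  next
    fix m n :: nat and f g :: "cantor \<Rightarrow> cantor"
    assume "seg n \<circ> inv f = seg n \<circ> inv g" "m \<le> n"
    then show "seg m \<circ> inv f = seg m \<circ> inv g"
      unfolding fun_eq_iff comp_apply using seg_eq_mono by blast
  qed
  then show ?thesis
    by (simp add: fun_eq_iff)
qed

lemma openin_vietoris_level:
  "openin vietoris {Y. compact Y \<and> seg m ` Y = S}"
proof (cases "S \<subseteq> {s. length s = m}")
  case True
  have basic: "openin vietoris {K. compact K \<and> K \<subseteq> U}" "openin vietoris {K. compact K \<and> K \<inter> U \<noteq> {}}"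
    if "open U" for U
    unfolding vietoris_def using that by (blast intro: topology_generated_by_Basis)+
  have "open (\<Union>s\<in>S. {y :: cantor. seg m y = s})"
    by (intro open_UN ballI open_seg)
  moreover have "finite S"
    using True finite_bool_lists finite_subset by blast
  ultimately have "openin vietoris ({K. compact K \<and> K \<subseteq> (\<Union>s\<in>S. {y. seg m y = s})} \<inter>
      ((\<Inter>s\<in>S. {K. compact K \<and> K \<inter> {y. seg m y = s} \<noteq> {}}) \<inter> topspace vietoris))"
    by (intro openin_Int openin_INT basic open_seg)
  moreover have "seg m ` Y = S \<longleftrightarrow>
      Y \<subseteq> (\<Union>s\<in>S. {y. seg m y = s}) \<and> (\<forall>s\<in>S. Y \<inter> {y. seg m y = s} \<noteq> {})" for Y :: "cantor set"
  proof -
    have "seg m ` Y \<subseteq> S \<longleftrightarrow> Y \<subseteq> (\<Union>s\<in>S. {y. seg m y = s})"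
      by auto
    moreover have "S \<subseteq> seg m ` Y \<longleftrightarrow> (\<forall>s\<in>S. Y \<inter> {y. seg m y = s} \<noteq> {})"
      by (auto simp: image_iff disjoint_iff subset_iff eq_commute)
    ultimately show ?thesis
      by (simp only: set_eq_subset)
  qed
  then have "{Y. compact Y \<and> seg m ` Y = S} =
     {K. compact K \<and> K \<subseteq> (\<Union>s\<in>S. {y. seg m y = s})} \<inter>
      ((\<Inter>s\<in>S. {K. compact K \<and> K \<inter> {y. seg m y = s} \<noteq> {}}) \<inter> topspace vietoris)"
    unfolding topspace_vietoris by (simp only: set_eq_iff Int_iff mem_Collect_eq INT_iff) blast
  ultimately show ?thesis
    by simp
next
  case False
  then have "{Y. compact Y \<and> seg m ` Y = S} = {}"
    by auto
  then show ?thesis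
    by (simp only: openin_empty)
qed

text \<open>The digits of the values of \<open>f\<close> are fixed by requiring that the preimages of the cylinders are
  mapped onto these cylinders, those of \<open>inv f\<close> by prescribing the images of the cylinders.\<close>

lemma openin_homeo_level:
  assumes "f \<in> homeos"
  shows "openin homeo_topology
    {g \<in> homeos. (\<forall>x. seg m (g x) = seg m (f x)) \<and> (\<forall>x. seg m (inv g x) = seg m (inv f x))}"
proof -
  let ?L = "{s :: bool list. length s = m}"
  let ?C = "\<lambda>s. {x :: cantor. seg m x = s}"
  let ?A = "\<lambda>s. {x. seg m (f x) = s}" and ?B = "\<lambda>s. {x. seg m (inv f x) = s}"
  have basic: "openin homeo_topology {g \<in> homeos. g ` U = V}"
    if "clopen_in euclidean U" "clopen_in euclidean V" for U V
    unfolding homeo_topology_def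
    by (rule topology_generated_by_Basis, rule CollectI, rule exI[of _ 1], rule exI[of _ "\<lambda>_. U"],
        rule exI[of _ "\<lambda>_. V"]) (use that in auto)
  have clopen: "clopen_in euclidean {x. seg m (h x) = s}" if "continuous_on UNIV h" for h :: "cantor \<Rightarrow> cantor" and s
    unfolding clopen_iff_locally_constant
    using locally_constant_compose[OF continuous_seg_locally_constant[OF that], of "\<lambda>t. t = s" m]
    by (simp add: comp_def)
  have "openin homeo_topology ((\<Inter>s\<in>?L. {g \<in> homeos. g ` ?A s = ?C s}) \<inter> (\<Inter>s\<in>?L. {g \<in> homeos. g ` ?C s = ?B s}))"
    using clopen[OF homeosD(1)[OF assms]] clopen[OF homeosD(2)[OF assms]] clopen[OF continuous_on_id]
      Ex_list_of_length[of m]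
    by (intro openin_Int openin_INT2 finite_bool_lists basic) auto
  moreover have "{g \<in> homeos. (\<forall>x. seg m (g x) = seg m (f x)) \<and> (\<forall>x. seg m (inv g x) = seg m (inv f x))} =
      (\<Inter>s\<in>?L. {g \<in> homeos. g ` ?A s = ?C s}) \<inter> (\<Inter>s\<in>?L. {g \<in> homeos. g ` ?C s = ?B s})"
  proof -
    have 1: "(\<forall>x. seg m (g x) = seg m (f x)) \<longleftrightarrow> (\<forall>s\<in>?L. g ` ?A s = ?C s)" if g: "g \<in> homeos" for g
    proof
      assume *: "\<forall>x. seg m (g x) = seg m (f x)"
      have "y \<in> g ` ?A (seg m y)" for y
      proof (rule image_eqI[of _ _ "inv g y"])
        show "inv g y \<in> ?A (seg m y)"
          using *[rule_format, of "inv g y"] homeosD(5)[OF g, of y] by simp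
      qed (simp add: homeosD(5)[OF g])
      moreover have "g ` ?A s \<subseteq> ?C s" for s
        using * by auto
      ultimately show "\<forall>s\<in>?L. g ` ?A s = ?C s"
        by blast
    next
      assume *: "\<forall>s\<in>?L. g ` ?A s = ?C s"
      have "g x \<in> ?C (seg m (f x))" for x
        using * by (metis (mono_tags, lifting) image_eqI length_seg mem_Collect_eq)
      then show "\<forall>x. seg m (g x) = seg m (f x)"
        by blast
    qed
    have 2: "(\<forall>x. seg m (inv g x) = seg m (inv f x)) \<longleftrightarrow> (\<forall>s\<in>?L. g ` ?C s = ?B s)" if g: "g \<in> homeos" for g
    proof
      assume *: "\<forall>x. seg m (inv g x) = seg m (inv f x)"
      have "y \<in> g ` ?C (seg m (inv f y))" for y
        by (rule image_eqI[of _ _ "inv g y"]) (use * homeosD(5)[OF g, of y] in simp_all)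
      moreover have "seg m (inv f (g x)) = seg m x" for x
        using *[rule_format, of "g x"] homeosD(4)[OF g] by simp
      then have "g ` ?C s \<subseteq> ?B s" for s
        by auto
      ultimately show "\<forall>s\<in>?L. g ` ?C s = ?B s"
        by blast
    next
      assume *: "\<forall>s\<in>?L. g ` ?C s = ?B s"
      have "g (inv g x) \<in> ?B (seg m (inv g x))" for x
        using * by (metis (mono_tags, lifting) image_eqI length_seg mem_Collect_eq)
      then show "\<forall>x. seg m (inv g x) = seg m (inv f x)"
        using homeosD(5)[OF g] by simp
    qed
    obtain s0 :: "bool list" where s0: "s0 \<in> ?L"
      using Ex_list_of_length[of m] by blast
    show ?thesis
    proof (intro set_eqI iffI)
      fix g
      assume "g \<in> {g \<in> homeos. (\<forall>x. seg m (g x) = seg m (f x)) \<and> (\<forall>x. seg m (inv g x) = seg m (inv f x))}"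
      then have g: "g \<in> homeos" and "\<forall>x. seg m (g x) = seg m (f x)" "\<forall>x. seg m (inv g x) = seg m (inv f x)"
        by simp_all
      then have "\<forall>s\<in>?L. g ` ?A s = ?C s" "\<forall>s\<in>?L. g ` ?C s = ?B s"
        using 1[OF g] 2[OF g] by simp_all
      then show "g \<in> (\<Inter>s\<in>?L. {g \<in> homeos. g ` ?A s = ?C s}) \<inter> (\<Inter>s\<in>?L. {g \<in> homeos. g ` ?C s = ?B s})"
        using g by simp
    next
      fix g
      assume g': "g \<in> (\<Inter>s\<in>?L. {g \<in> homeos. g ` ?A s = ?C s}) \<inter> (\<Inter>s\<in>?L. {g \<in> homeos. g ` ?C s = ?B s})"
      then have g: "g \<in> homeos"
        using s0 by (simp only: Int_iff INT_iff mem_Collect_eq)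
      have "\<forall>s\<in>?L. g ` ?A s = ?C s" "\<forall>s\<in>?L. g ` ?C s = ?B s"
        using g' by simp_all
      then show "g \<in> {g \<in> homeos. (\<forall>x. seg m (g x) = seg m (f x)) \<and> (\<forall>x. seg m (inv g x) = seg m (inv f x))}"
        using 1[OF g] 2[OF g] g by simp
    qed
  qed
  ultimately show ?thesis
    by simp
qed

text \<open>The combinatorial description of the topology, which replaces the Vietoris topology and the
  topology of the homeomorphism group in everything that follows.\<close>

lemma openin_P_space_iff:
  "openin P_space U \<longleftrightarrow> U \<subseteq> P_set \<and> (\<forall>p\<in>U. \<exists>m. \<forall>q\<in>P_set. level m q = level m p \<longrightarrow> q \<in> U)"
proof (intro iffI conjI ballI)
  assume U: "openin P_space U"
  then show "U \<subseteq> P_set"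
    using openin_subset topspace_P_space by blast
  fix p assume "p \<in> U"
  obtain W where W: "openin (prod_topology vietoris homeo_topology) W" "U = W \<inter> P_set"
    using U by (auto simp: P_space_def openin_subtopology)
  have "(fst p, snd p) \<in> W"
    using W(2) \<open>p \<in> U\<close> by simp
  from W(1)[unfolded openin_prod_topology_alt, rule_format, OF this]
  obtain A B where AB: "openin vietoris A" "openin homeo_topology B" "fst p \<in> A" "snd p \<in> B" "A \<times> B \<subseteq> W"
    by (elim exE conjE)
  obtain a where a: "\<forall>Y. compact Y \<and> seg a ` Y = seg a ` fst p \<longrightarrow> Y \<in> A"
    using vietoris_levels[OF AB(1,3)] by blast
  obtain b where b: "\<forall>g\<in>homeos. (\<forall>x. seg b (inv g x) = seg b (inv (snd p) x)) \<longrightarrow> g \<in> B"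
    using homeo_levels[OF AB(2,4)] by blast
  have "q \<in> U" if q: "q \<in> P_set" and eq: "level (max a b) q = level (max a b) p" for q
  proof -
    have "fst q \<in> A"
      using a P_setD(1)[OF q] level_eq_mono[OF eq max.cobounded1] unfolding level_eq_iff by blast
    moreover have "snd q \<in> B"
      using b P_setD(2)[OF q] level_eq_mono[OF eq max.cobounded2] unfolding level_eq_iff by blast
    ultimately have "q \<in> A \<times> B"
      by (simp add: mem_Times_iff)
    then show ?thesis
      using AB(5) W(2) q by blast
  qed
  then show "\<exists>m. \<forall>q\<in>P_set. level m q = level m p \<longrightarrow> q \<in> U"
    by blast
next
  assume *: "U \<subseteq> P_set \<and> (\<forall>p\<in>U. \<exists>m. \<forall>q\<in>P_set. level m q = level m p \<longrightarrow> q \<in> U)"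
  have "\<exists>T. openin P_space T \<and> p \<in> T \<and> T \<subseteq> U" if pU: "p \<in> U" for p
  proof -
    obtain m where m: "\<forall>q\<in>P_set. level m q = level m p \<longrightarrow> q \<in> U"
      using conjunct2[OF *, rule_format, OF pU] ..
    have p: "p \<in> P_set"
      using * pU by blast
    let ?A = "{Y. compact Y \<and> seg m ` Y = seg m ` fst p}"
    let ?B = "{g \<in> homeos. (\<forall>x. seg m (g x) = seg m (snd p x)) \<and>
        (\<forall>x. seg m (inv g x) = seg m (inv (snd p) x))}"
    have "openin (prod_topology vietoris homeo_topology) (?A \<times> ?B)"
      unfolding openin_prod_Times_iff
      by (intro disjI2 conjI openin_vietoris_level openin_homeo_level P_setD(2)[OF p])
    then have "openin P_space ((?A \<times> ?B) \<inter> P_set)"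
      unfolding P_space_def openin_subtopology by (intro exI[of _ "?A \<times> ?B"] conjI refl)
    moreover have "p \<in> (?A \<times> ?B) \<inter> P_set"
      using p P_setD[OF p] by (simp add: mem_Times_iff)
    moreover have "(?A \<times> ?B) \<inter> P_set \<subseteq> U"
    proof
      fix q assume q: "q \<in> (?A \<times> ?B) \<inter> P_set"
      then have "level m q = level m p"
        unfolding level_eq_iff by (simp add: mem_Times_iff)
      then show "q \<in> U"
        using m q by simp
    qed
    ultimately show ?thesis
      by (intro exI conjI)
  qed
  then show "openin P_space U"
    by (subst openin_subopen) blast
qed

text \<open>The reductions below are all of this form: each level of the value depends on finitely many
  clopen conditions on the argument.\<close>

lemma continuous_into_P_space:
  assumes V: "\<And>i::nat. clopen_in Z (V i)"
    and F: "\<And>z. z \<in> topspace Z \<Longrightarrow> F z \<in> P_set"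
    and dep: "\<And>m z z'. z \<in> topspace Z \<Longrightarrow> z' \<in> topspace Z \<Longrightarrow> \<forall>i<m. z \<in> V i \<longleftrightarrow> z' \<in> V i \<Longrightarrow>
      level m (F z) = level m (F z')"
  shows "continuous_map Z P_space F"
  unfolding continuous_map_def topspace_P_space
proof (intro conjI allI impI)
  fix U assume U: "openin P_space U"
  have "\<exists>T. openin Z T \<and> z \<in> T \<and> T \<subseteq> {z \<in> topspace Z. F z \<in> U}" if z: "z \<in> topspace Z" "F z \<in> U" for z
  proof -
    obtain m where m: "\<forall>q\<in>P_set. level m q = level m (F z) \<longrightarrow> q \<in> U"
      using U z(2) unfolding openin_P_space_iff by blast
    let ?T = "(\<Inter>i\<in>{..<m}. if z \<in> V i then V i else topspace Z - V i) \<inter> topspace Z"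
    have "openin Z (if z \<in> V i then V i else topspace Z - V i)" for i
      using V[of i] by (auto simp: clopen_in_def)
    then have "openin Z ?T"
      by (intro openin_INT finite_lessThan)
    moreover have "z \<in> ?T"
      using z(1) by auto
    moreover have "F y \<in> U" if y: "y \<in> ?T" for y
    proof -
      have "\<forall>i<m. y \<in> V i \<longleftrightarrow> z \<in> V i"
        using y by (auto split: if_splits)
      then show ?thesis
        using m F dep[of y z m] y z(1) by blast
    qed
    ultimately show ?thesis
      by blast
  qed
  then show "openin Z {z \<in> topspace Z. F z \<in> U}"
    by (subst openin_subopen) blast
qed (use F in auto)

section \<open>Polishness\<close>

text \<open>Sending a point to the sequence of its levels embeds the space into a countable product of
  discrete spaces. The hypothesis on limits makes the image closed, which gives a complete metric, and
  one point for each of the countably many possible levels gives a dense set.\<close>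

lemma polish_if_levels:
  fixes lev :: "nat \<Rightarrow> 'a \<Rightarrow> 'd"
  assumes open_iff: "\<And>U. openin X U \<longleftrightarrow>
      U \<subseteq> topspace X \<and> (\<forall>p\<in>U. \<exists>m. \<forall>q\<in>topspace X. lev m q = lev m p \<longrightarrow> q \<in> U)"
    and separate: "\<And>p q. p \<in> topspace X \<Longrightarrow> q \<in> topspace X \<Longrightarrow> \<forall>m. lev m p = lev m q \<Longrightarrow> p = q"
    and countable: "\<And>m. countable (lev m ` topspace X)"
    and limit: "\<And>p. \<forall>m. p m \<in> topspace X \<Longrightarrow> \<forall>m n. m \<le> n \<longrightarrow> lev m (p n) = lev m (p m) \<Longrightarrow>
      \<exists>q\<in>topspace X. \<forall>m. lev m q = lev m (p m)"
  shows "polish X"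
proof -
  define Y where "Y = product_topology (\<lambda>m. discrete_topology (lev m ` topspace X)) (UNIV :: nat set)"
  define \<Phi> where "\<Phi> p = (\<lambda>m. lev m p)" for p
  have topY: "topspace Y = {w. \<forall>m. w m \<in> lev m ` topspace X}"
    by (auto simp: Y_def PiE_iff)
  have openY: "openin Y {w \<in> topspace Y. w m = v}" for m v
  proof -
    have "continuous_map Y (discrete_topology (lev m ` topspace X)) (\<lambda>w. w m)"
      unfolding Y_def by (rule continuous_map_product_projection) simp
    then have "openin Y {w \<in> topspace Y. w m \<in> {v} \<inter> lev m ` topspace X}"
      by (rule openin_continuous_map_preimage) simp
    moreover have "{w \<in> topspace Y. w m \<in> {v} \<inter> lev m ` topspace X} = {w \<in> topspace Y. w m = v}"
      by (auto simp: topY)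
    ultimately show ?thesis
      by simp
  qed
  have sub: "\<Phi> ` topspace X \<subseteq> topspace Y"
    by (auto simp: topY \<Phi>_def)

  have cont: "continuous_map X Y \<Phi>"
    unfolding Y_def continuous_map_componentwise_UNIV
  proof
    fix m
    show "continuous_map X (discrete_topology (lev m ` topspace X)) (\<lambda>p. \<Phi> p m)"
      unfolding continuous_map_def
    proof (intro conjI allI impI)
      fix U
      show "openin X {p \<in> topspace X. \<Phi> p m \<in> U}"
        unfolding open_iff \<Phi>_def by (auto intro!: exI[of _ m])
    qed (auto simp: \<Phi>_def)
  qed

  have homeo: "homeomorphic_map X (subtopology Y (\<Phi> ` topspace X)) \<Phi>"
  proof (rule bijective_open_imp_homeomorphic_map)
    show "continuous_map X (subtopology Y (\<Phi> ` topspace X)) \<Phi>"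
      using cont by (simp add: continuous_map_into_subtopology)
    show "\<Phi> ` topspace X = topspace (subtopology Y (\<Phi> ` topspace X))"
      using sub by (auto simp: topspace_subtopology)
    show "inj_on \<Phi> (topspace X)"
      by (rule inj_onI) (auto simp: \<Phi>_def fun_eq_iff intro: separate)
    show "open_map X (subtopology Y (\<Phi> ` topspace X)) \<Phi>"
      unfolding open_map_def
    proof (intro allI impI)
      fix U assume U: "openin X U"
      then have "\<forall>p\<in>U. \<exists>m. \<forall>q\<in>topspace X. lev m q = lev m p \<longrightarrow> q \<in> U"
        unfolding open_iff by blast
      then obtain M where M: "\<forall>p\<in>U. \<forall>q\<in>topspace X. lev (M p) q = lev (M p) p \<longrightarrow> q \<in> U"
        unfolding bchoice_iff by blast
      let ?W = "\<Union>p\<in>U. {w \<in> topspace Y. w (M p) = lev (M p) p}"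
      have "openin Y ?W"
        using openY by blast
      moreover have "\<Phi> ` U = ?W \<inter> \<Phi> ` topspace X"
      proof (intro subset_antisym subsetI)
        fix w assume "w \<in> \<Phi> ` U"
        then show "w \<in> ?W \<inter> \<Phi> ` topspace X"
          using sub openin_subset[OF U] by (auto simp: \<Phi>_def)
      next
        fix w assume "w \<in> ?W \<inter> \<Phi> ` topspace X"
        then obtain p q where "p \<in> U" "q \<in> topspace X" "w = \<Phi> q" "lev (M p) q = lev (M p) p"
          by (auto simp: \<Phi>_def)
        then show "w \<in> \<Phi> ` U"
          using M by blast
      qed
      ultimately show "openin (subtopology Y (\<Phi> ` topspace X)) (\<Phi> ` U)"
        unfolding openin_subtopology by blast
    qed
  qed

  have closed: "closedin Y (\<Phi> ` topspace X)"
  proof -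
    have "\<exists>T. openin Y T \<and> w \<in> T \<and> T \<subseteq> topspace Y - \<Phi> ` topspace X"
      if w: "w \<in> topspace Y" "w \<notin> \<Phi> ` topspace X" for w
    proof -
      \<comment> \<open>If \<open>w\<close> agreed with points up to arbitrarily high levels, it would come from their limit.\<close>
      have "\<exists>m. \<forall>p\<in>topspace X. \<exists>i\<le>m. lev i p \<noteq> w i"
      proof (rule ccontr)
        assume "\<not> ?thesis"
        then have "\<forall>m. \<exists>p. p \<in> topspace X \<and> (\<forall>i\<le>m. lev i p = w i)"
          by blast
        then obtain p where p: "\<forall>m. p m \<in> topspace X \<and> (\<forall>i\<le>m. lev i (p m) = w i)"
          by (rule choice[THEN exE])
        have "\<exists>q\<in>topspace X. \<forall>m. lev m q = lev m (p m)"
          by (rule limit) (use p in simp_all)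
        then obtain q where "q \<in> topspace X" "\<forall>m. lev m q = w m"
          using p by auto
        then show False
          using w(2) by (auto simp: \<Phi>_def fun_eq_iff image_iff)
      qed
      then obtain m where m: "\<forall>p\<in>topspace X. \<exists>i\<le>m. lev i p \<noteq> w i" ..
      let ?T = "(\<Inter>i\<in>{..m}. {v \<in> topspace Y. v i = w i}) \<inter> topspace Y"
      have "openin Y ?T"
        by (intro openin_INT finite_atMost openY)
      moreover have "w \<in> ?T"
        using w(1) by simp
      moreover have "?T \<inter> \<Phi> ` topspace X = {}"
        using m by (fastforce simp: \<Phi>_def)
      ultimately show ?thesis
        by blast
    qed
    then have "openin Y (topspace Y - \<Phi> ` topspace X)"
      by (subst openin_subopen) blast
    then show ?thesis
      using sub by (simp add: closedin_def)
  qed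

  have "completely_metrizable_space Y"
    unfolding Y_def completely_metrizable_space_product_topology
    using completely_metrizable_space_discrete_topology by (blast intro: countableI_type)
  then have "completely_metrizable_space X"
    using completely_metrizable_space_closedin[OF _ closed] homeo
      homeomorphic_completely_metrizable_space homeomorphic_map_imp_homeomorphic_space by blast
  moreover have "separable_space X"
  proof -
    define pick where "pick m v = (SOME p. p \<in> topspace X \<and> lev m p = v)" for m v
    have pick: "pick m (lev m p) \<in> topspace X \<and> lev m (pick m (lev m p)) = lev m p"
      if "p \<in> topspace X" for m p
      unfolding pick_def by (rule someI[of _ p]) (use that in simp)
    define C where "C = (\<Union>m. pick m ` lev m ` topspace X)"
    have "countable C"
      unfolding C_def by (intro countable_UN countable_image countable countableI_type)
    moreover have "C \<subseteq> topspace X"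
      using pick by (auto simp: C_def)
    moreover have "X closure_of C = topspace X"
    proof (intro subset_antisym closure_of_subset_topspace subsetI)
      fix p assume p: "p \<in> topspace X"
      have "\<exists>y\<in>C. y \<in> T" if T: "p \<in> T" "openin X T" for T
      proof -
        obtain m where "\<forall>q\<in>topspace X. lev m q = lev m p \<longrightarrow> q \<in> T"
          using T open_iff by blast
        then have "pick m (lev m p) \<in> T"
          using pick[OF p] by blast
        then show ?thesis
          using p by (auto simp: C_def)
      qed
      then show "p \<in> X closure_of C"
        using p by (auto simp: in_closure_of)
    qed
    ultimately show ?thesis
      unfolding separable_space_def by blast
  qed
  ultimately show ?thesis
    by (simp add: polish_def)
qed

text \<open>The limit is the diagonal: digit \<open>k\<close> no longer changes from \<open>y (Suc k)\<close> on.\<close>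

lemma seg_limit:
  assumes "\<And>i. seg (m + i) (y (Suc i)) = seg (m + i) (y i)"
  shows "\<exists>z. \<forall>i. seg (m + i) z = seg (m + i) (y i)"
proof -
  have coh: "seg (m + i) (y j) = seg (m + i) (y i)" if "i \<le> j" for i j
    using that
  proof (induction j rule: dec_induct)
    case (step n)
    have "seg (m + i) (y (Suc n)) = seg (m + i) (y n)"
      by (rule seg_eq_mono[OF assms[of n]]) (use step in simp)
    then show ?case
      using step.IH by simp
  qed simp
  have "seg (m + i) (\<lambda>k. y (Suc k) k) = seg (m + i) (y i)" for i
    unfolding seg_eq_iff
  proof (intro allI impI)
    fix k assume k: "k < m + i"
    show "y (Suc k) k = y i k"
    proof (cases "Suc k \<le> i")
      case True
      then show ?thesis
        using coh[OF True] by (simp add: seg_eq_iff)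
    next
      case False
      then show ?thesis
        using coh[of i "Suc k"] k by (simp add: seg_eq_iff)
    qed
  qed
  then show ?thesis
    by (intro exI[of _ "\<lambda>k. y (Suc k) k"]) blast
qed

text \<open>Continuity of the limit \<open>f\<close> provides a modulus that is independent of \<open>n\<close>; it allows \<open>g x\<close> to be
  replaced by \<open>G n x\<close> inside \<open>f\<close> for large \<open>n\<close>.\<close>

lemma uniform_limit_inverse:
  fixes f g :: "cantor \<Rightarrow> cantor"
  assumes f: "\<And>m n x. m \<le> n \<Longrightarrow> seg m (f x) = seg m (F n x)" "continuous_on UNIV f"
    and g: "\<And>m n x. m \<le> n \<Longrightarrow> seg m (g x) = seg m (G n x)"
    and inv: "\<And>n x. F n (G n x) = x"
  shows "f (g x) = x"
proof (rule ext_seg)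
  fix m
  obtain n where n: "\<forall>x y. seg n x = seg n y \<longrightarrow> seg m (f x) = seg m (f y)"
    using continuous_seg_locally_constant[OF f(2), of m] by (auto simp: locally_constant_def)
  have "seg n (g x) = seg n (G (max m n) x)"
    by (rule g) simp
  then have "seg m (f (g x)) = seg m (f (G (max m n) x))"
    using n by blast
  also have "\<dots> = seg m (F (max m n) (G (max m n) x))"
    by (rule f) simp
  finally show "seg m (f (g x)) = seg m x"
    by (simp add: inv)
qed

text \<open>A point of the limit set is close to a point of \<open>X n\<close>, where \<open>F n\<close> can be applied.\<close>

lemma uniform_limit_invariant:
  fixes f :: "cantor \<Rightarrow> cantor"
  assumes f: "\<And>m n x. m \<le> n \<Longrightarrow> seg m (f x) = seg m (F n x)" "continuous_on UNIV f"
    and X: "\<And>m n. m \<le> n \<Longrightarrow> seg m ` X n = seg m ` X m"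
    and F: "\<And>n x. x \<in> X n \<Longrightarrow> F n x \<in> X n"
    and x: "\<And>m. seg m x \<in> seg m ` X m"
  shows "seg m (f x) \<in> seg m ` X m"
proof -
  obtain n where n: "\<forall>x y. seg n x = seg n y \<longrightarrow> seg m (f x) = seg m (f y)"
    using continuous_seg_locally_constant[OF f(2), of m] by (auto simp: locally_constant_def)
  let ?k = "max m n"
  obtain x' where x': "x' \<in> X ?k" "seg ?k x = seg ?k x'"
    using x[of ?k] by auto
  have "seg n x = seg n x'"
    by (rule seg_eq_mono[OF x'(2)]) simp
  then have "seg m (f x) = seg m (f x')"
    using n by blast
  also have "\<dots> = seg m (F ?k x')"
    by (rule f) simp
  also have "\<dots> \<in> seg m ` X ?k"
    using F x'(1) by blast
  also have "\<dots> = seg m ` X m"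
    by (rule X) simp
  finally show ?thesis .
qed

text \<open>The sets \<open>seg m ` X m\<close> form a tree in which every node has an extension of the next length, so each
  node extends to a branch.\<close>

lemma seg_levels_limit:
  fixes X :: "nat \<Rightarrow> cantor set"
  assumes X: "\<And>m n. m \<le> n \<Longrightarrow> seg m ` X n = seg m ` X m"
  shows "seg m ` {x. \<forall>m. seg m x \<in> seg m ` X m} = seg m ` X m"
proof (intro subset_antisym subsetI)
  fix s assume "s \<in> seg m ` X m"
  then obtain x0 where x0: "x0 \<in> X m" "s = seg m x0"
    by blast
  \<comment> \<open>Dependent choice, with the starting point \<open>x0\<close> imposed by the clause for \<open>i = 0\<close>.\<close>
  have "\<exists>y. \<forall>i. (y i \<in> X (m + i) \<and> (i = 0 \<longrightarrow> y i = x0)) \<and> seg (m + i) (y (Suc i)) = seg (m + i) (y i)"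
  proof (rule dependent_nat_choice)
    show "\<exists>x. x \<in> X (m + 0) \<and> (0 = (0::nat) \<longrightarrow> x = x0)"
      using x0 by auto
  next
    fix x i
    assume "x \<in> X (m + i) \<and> (i = 0 \<longrightarrow> x = x0)"
    then have "seg (m + i) x \<in> seg (m + i) ` X (m + Suc i)"
      using X[of "m + i" "m + Suc i"] by simp
    then show "\<exists>y. (y \<in> X (m + Suc i) \<and> (Suc i = 0 \<longrightarrow> y = x0)) \<and> seg (m + i) y = seg (m + i) x"
      by auto
  qed
  then obtain y where y: "\<And>i. y i \<in> X (m + i)" "y 0 = x0"
      "\<And>i. seg (m + i) (y (Suc i)) = seg (m + i) (y i)"
    by blast
  obtain z where z: "\<And>i. seg (m + i) z = seg (m + i) (y i)"
    using seg_limit[OF y(3)] by blast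
  have "seg k z \<in> seg k ` X k" for k
  proof -
    have "seg k z = seg k (y k)"
      by (rule seg_eq_mono[OF z]) simp
    then show ?thesis
      using imageI[OF y(1)[of k], of "seg k"] unfolding X[OF le_add2] by simp
  qed
  moreover have "seg m z = s"
    using z[of 0] y(2) x0(2) by simp
  ultimately show "s \<in> seg m ` {x. \<forall>m. seg m x \<in> seg m ` X m}"
    by blast
qed blast

lemma closed_levels: "closed {x :: cantor. \<forall>m. seg m x \<in> S m}"
  unfolding closed_def open_iff_seg
proof
  fix x assume "x \<in> - {x :: cantor. \<forall>m. seg m x \<in> S m}"
  then obtain m where "seg m x \<notin> S m"
    by blast
  then have "\<forall>y. seg m y = seg m x \<longrightarrow> y \<in> - {x. \<forall>m. seg m x \<in> S m}"
    by (metis (mono_tags) ComplI mem_Collect_eq)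
  then show "\<exists>n. \<forall>y. seg n y = seg n x \<longrightarrow> y \<in> - {x. \<forall>m. seg m x \<in> S m}" ..
qed

lemma closed_cantorD:
  fixes X :: "cantor set"
  assumes "closed X" "\<And>m. seg m x \<in> seg m ` X"
  shows "x \<in> X"
proof (rule ccontr)
  assume "x \<notin> X"
  then obtain n where "\<forall>y. seg n y = seg n x \<longrightarrow> y \<in> - X"
    using \<open>closed X\<close> unfolding closed_def open_iff_seg by blast
  moreover obtain y where "y \<in> X" "seg n x = seg n y"
    using assms(2)[of n] by blast
  ultimately show False
    by auto
qed

theorem polish_P_space: "polish P_space"
proof (rule polish_if_levels[of _ level])
  show "openin P_space U \<longleftrightarrow> U \<subseteq> topspace P_space \<and>
      (\<forall>p\<in>U. \<exists>m. \<forall>q\<in>topspace P_space. level m q = level m p \<longrightarrow> q \<in> U)" for U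
    unfolding topspace_P_space by (rule openin_P_space_iff)
next
  fix p q assume "p \<in> topspace P_space" "q \<in> topspace P_space" and eq: "\<forall>m. level m p = level m q"
  then have closed: "closed (fst p)" "closed (fst q)"
    using P_setD(1) unfolding topspace_P_space compact_iff_closed_cantor by blast+
  have seg: "seg m ` fst p = seg m ` fst q" for m
    using eq unfolding level_eq_iff by blast
  have "fst p = fst q"
  proof (intro subset_antisym subsetI)
    fix x assume "x \<in> fst p"
    then show "x \<in> fst q"
      by (intro closed_cantorD[OF closed(2)]) (simp flip: seg)
  next
    fix x assume "x \<in> fst q"
    then show "x \<in> fst p"
      by (intro closed_cantorD[OF closed(1)]) (simp add: seg)
  qed
  moreover have "snd p = snd q"
    using eq unfolding level_eq_iff by (intro ext ext_seg) blast
  ultimately show "p = q"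
    by (rule prod_eqI)
next
  fix m
  have "level m ` topspace P_space \<subseteq> Pow {s. length s = m} \<times> locally_constant \<times> locally_constant"
    unfolding topspace_P_space level_def
    using continuous_seg_locally_constant homeosD(1,2) P_setD(2) by auto
  moreover have "countable \<dots>"
    by (intro countable_SIGMA countable_locally_constant countable_finite) (simp_all add: finite_bool_lists)
  ultimately show "countable (level m ` topspace P_space)"
    by (rule countable_subset)
next
  fix p assume p: "\<forall>m. p m \<in> topspace P_space" and coh: "\<forall>m n. m \<le> n \<longrightarrow> level m (p n) = level m (p m)"
  define X F G where "X n = fst (p n)" and "F n = snd (p n)" and "G n = inv (snd (p n))" for n
  have P: "p n \<in> P_set" for n
    using p by (simp add: topspace_P_space)
  have X: "seg m ` X n = seg m ` X m" and F: "seg m (F n x) = seg m (F m x)"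
    and G: "seg m (G n x) = seg m (G m x)" if "m \<le> n" for m n x
    using coh that unfolding level_eq_iff X_def F_def G_def by blast+
  have homeo: "continuous_on UNIV (F n)" "continuous_on UNIV (G n)"
    "G n (F n x) = x" "F n (G n x) = x" for n x
    unfolding F_def G_def by (rule homeosD[OF P_setD(2)[OF P]])+
  have limits: "\<exists>h. \<forall>m n x. m \<le> n \<longrightarrow> seg m (h x) = seg m (H n x)"
    if H: "\<And>m n x. m \<le> n \<Longrightarrow> seg m (H n x) = seg m (H m x)" for H :: "nat \<Rightarrow> cantor \<Rightarrow> cantor"
  proof -
    have "\<exists>z. \<forall>i. seg i z = seg i (H i x)" for x
      using seg_limit[of 0 "\<lambda>i. H i x", unfolded add_0, OF H] le_SucI[OF order_refl] by blast
    then obtain h where h: "\<forall>x. \<forall>i. seg i (h x) = seg i (H i x)"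
      using choice[of "\<lambda>x z. \<forall>i. seg i z = seg i (H i x)"] by blast
    have "seg m (h x) = seg m (H n x)" if "m \<le> n" for m n x
      using h[rule_format, of m x] H[OF that, of x] by (rule trans[OF _ sym])
    then show ?thesis
      by blast
  qed
  obtain f where "\<forall>m n x. m \<le> n \<longrightarrow> seg m (f x) = seg m (F n x)"
    using limits[of F, OF F] by (rule exE)
  note f = this[rule_format]
  obtain g where "\<forall>m n x. m \<le> n \<longrightarrow> seg m (g x) = seg m (G n x)"
    using limits[of G, OF G] by (rule exE)
  note g = this[rule_format]
  have cont: "continuous_on UNIV h"
    if "\<And>m n x. m \<le> n \<Longrightarrow> seg m (h x) = seg m (H n x)" "\<And>n. continuous_on UNIV (H n)"
    for h :: "cantor \<Rightarrow> cantor" and H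
  proof (rule continuous_if_seg_locally_constant)
    fix m
    have "seg m \<circ> h = seg m \<circ> H m"
      unfolding fun_eq_iff comp_apply using that(1)[OF order_refl] by blast
    then show "seg m \<circ> h \<in> locally_constant"
      using continuous_seg_locally_constant[OF that(2)] by simp
  qed
  have cf: "continuous_on UNIV f" and cg: "continuous_on UNIV g"
    using cont[of f F, OF f homeo(1)] cont[of g G, OF g homeo(2)] by simp_all
  have fg: "f (g x) = x" and gf: "g (f x) = x" for x
    using uniform_limit_inverse[of f F g G, OF f cf g homeo(4)]
      uniform_limit_inverse[of g G f F, OF g cg f homeo(3)]
    by simp_all
  have "f \<in> homeos" "inv f = g"
    using homeosI[OF cf cg gf fg] by simp_all
  define K where "K = {x. \<forall>m. seg m x \<in> seg m ` X m}"
  have "closed K"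
    unfolding K_def by (rule closed_levels)
  have maps: "F n x \<in> X n" "G n x \<in> X n" if x: "x \<in> X n" for n x
  proof -
    have "F n ` X n = X n"
      using P_setD(3)[OF P] by (simp add: F_def X_def)
    then show "F n x \<in> X n"
      using that by blast
    obtain y where "y \<in> X n" "x = F n y"
      using \<open>F n ` X n = X n\<close> x by blast
    then show "G n x \<in> X n"
      by (simp add: homeo(3))
  qed
  have "f x \<in> K" if "x \<in> K" for x
    using that uniform_limit_invariant[of f F X x, OF f cf X maps(1)] unfolding K_def by simp
  moreover have gK: "g x \<in> K" if "x \<in> K" for x
    using that uniform_limit_invariant[of g G X x, OF g cg X maps(2)] unfolding K_def by simp
  have "x \<in> f ` K" if "x \<in> K" for x
    by (rule image_eqI[of _ _ "g x"]) (simp_all add: fg gK that)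
  ultimately have "f ` K \<subseteq> K" "K \<subseteq> f ` K"
    by auto
  then have "f ` K = K"
    by blast
  with \<open>closed K\<close> \<open>f \<in> homeos\<close> have "(K, f) \<in> P_set"
    by (simp add: P_set_def compact_iff_closed_cantor)
  moreover have "level m (K, f) = level m (p m)" for m
    unfolding level_eq_iff fst_conv snd_conv \<open>inv f = g\<close>
    using f[OF order_refl] g[OF order_refl] seg_levels_limit[OF X]
    by (simp only: K_def X_def F_def G_def) simp
  ultimately show "\<exists>q\<in>topspace P_space. \<forall>m. level m q = level m (p m)"
    unfolding topspace_P_space by blast
qed

section \<open>Colourings\<close>

lemma continuously_colourable_mono:
  assumes "continuously_colourable T R \<kappa>" "\<kappa> \<le> \<mu>"
  shows "continuously_colourable T R \<mu>"
proof -
  obtain c where c: "continuous_map T (discrete_topology {n. enat n < \<kappa>}) c" "\<forall>(x, y)\<in>R. c x \<noteq> c y"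
    using assms(1) unfolding continuously_colourable_def by blast
  have "continuous_map T (discrete_topology {n. enat n < \<mu>}) c"
    unfolding continuous_map_def
  proof (intro conjI allI impI)
    have "{n. enat n < \<kappa>} \<subseteq> {n. enat n < \<mu>}"
      using assms(2) by auto
    then show "c \<in> topspace T \<rightarrow> topspace (discrete_topology {n. enat n < \<mu>})"
      using c(1) unfolding continuous_map_def by auto
    fix U
    have "openin T {x \<in> topspace T. c x \<in> U \<inter> {n. enat n < \<kappa>}}"
      using openin_continuous_map_preimage[OF c(1), of "U \<inter> {n. enat n < \<kappa>}"] by simp
    moreover have "{x \<in> topspace T. c x \<in> U \<inter> {n. enat n < \<kappa>}} = {x \<in> topspace T. c x \<in> U}"
      using c(1) unfolding continuous_map_def by auto
    ultimately show "openin T {x \<in> topspace T. c x \<in> U}"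
      by simp
  qed
  with c(2) show ?thesis
    unfolding continuously_colourable_def by blast
qed

lemma less_chi_c_iff: "Countable_card \<kappa> < chi_c T R \<longleftrightarrow> \<not> continuously_colourable T R \<kappa>"
proof (cases "\<exists>\<mu>. continuously_colourable T R \<mu>")
  case True
  let ?L = "LEAST \<mu>. continuously_colourable T R \<mu>"
  have "continuously_colourable T R ?L"
    using True by (rule LeastI_ex)
  then have "\<kappa> < ?L \<longleftrightarrow> \<not> continuously_colourable T R \<kappa>"
    using continuously_colourable_mono[of T R ?L \<kappa>] not_less_Least[of \<kappa>] by (meson not_le)
  then show ?thesis
    using True by (simp add: chi_c_def less_chromatic_card_def less_le_not_le)
next
  case False
  then show ?thesis
    by (simp add: chi_c_def less_chromatic_card_def)
qed

text \<open>The colour classes are clopen relative to \<open>X\<close>, hence by compactness the colour depends on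
  the first \<open>n\<close> digits for some \<open>n\<close>. Segments that miss \<open>X\<close> get the default colour \<open>d\<close>.\<close>

lemma continuous_on_compact_extends:
  fixes X :: "cantor set" and c :: "cantor \<Rightarrow> nat"
  assumes "compact X" and c: "continuous_map (top_of_set X) (discrete_topology C) c"
    and "d \<in> C"
  shows "\<exists>c'\<in>locally_constant. (\<forall>x. c' x \<in> C) \<and> (\<forall>x\<in>X. c' x = c x)"
proof -
  define Q where "Q s \<longleftrightarrow> (\<forall>y\<in>X. \<forall>z\<in>X. seg (length s) y = s \<longrightarrow> seg (length s) z = s \<longrightarrow> c y = c z)" for s
  have "\<exists>n. \<forall>x\<in>X. Q (seg n x)"
  proof (rule fan[OF \<open>compact X\<close>])
    fix x assume x: "x \<in> X"
    have cC: "c y \<in> C" if "y \<in> X" for y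
      using continuous_map_funspace[OF c] that by auto
    have "openin (top_of_set X) {y \<in> topspace (top_of_set X). c y \<in> {c x}}"
      by (rule openin_continuous_map_preimage[OF c]) (simp add: cC x)
    then obtain T where T: "open T" "{y \<in> X. c y = c x} = X \<inter> T"
      unfolding openin_open by auto
    have "x \<in> T"
      using T(2) x by blast
    then obtain n where n: "\<forall>y. seg n y = seg n x \<longrightarrow> y \<in> T"
      using T(1) unfolding open_iff_seg by blast
    have const: "c y = c x" if "y \<in> X" "seg n y = seg n x" for y
      using n T(2) that by blast
    have "Q (seg n x)"
      unfolding Q_def length_seg using const by metis
    then show "\<exists>n. Q (seg n x)" ..
  next
    fix x and m n :: nat
    assume "Q (seg m x)" "m \<le> n"
    then show "Q (seg n x)"
      unfolding Q_def length_seg using seg_eq_mono by blast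
  qed
  then obtain n where Q: "\<forall>x\<in>X. Q (seg n x)" ..
  have n: "c y = c x" if "x \<in> X" "y \<in> X" "seg n y = seg n x" for x y
    using Q that unfolding Q_def length_seg by blast
  define c' where "c' x = (if \<exists>y\<in>X. seg n y = seg n x then c (SOME y. y \<in> X \<and> seg n y = seg n x) else d)" for x
  have some: "c' x = c y" if "y \<in> X" "seg n y = seg n x" for x y
  proof -
    let ?y = "SOME y. y \<in> X \<and> seg n y = seg n x"
    have y: "?y \<in> X \<and> seg n ?y = seg n x"
      by (rule someI[of _ y]) (simp add: that)
    have "c' x = c ?y"
      unfolding c'_def using that by (intro if_P) blast
    also have "\<dots> = c y"
      by (rule n) (use y that in simp_all)
    finally show ?thesis .
  qed
  have "c' x = c' y" if "seg n x = seg n y" for x y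
    unfolding c'_def that ..
  then have "c' \<in> locally_constant"
    unfolding locally_constant_def by blast
  moreover have "c' x \<in> C" for x
  proof (cases "\<exists>y\<in>X. seg n y = seg n x")
    case True
    then obtain y where "y \<in> X" "c' x = c y"
      using some by blast
    then show ?thesis
      using continuous_map_funspace[OF c] by auto
  next
    case False
    then show ?thesis
      using \<open>d \<in> C\<close> unfolding c'_def by simp
  qed
  moreover have "c' x = c x" if "x \<in> X" for x
    using some[OF that refl] .
  ultimately show ?thesis
    by blast
qed

lemma locally_constant_continuous_map:
  assumes "c \<in> locally_constant" "\<And>x. x \<in> X \<Longrightarrow> c x \<in> C"
  shows "continuous_map (top_of_set X) (discrete_topology C) c"
  unfolding continuous_map_def
proof (intro conjI allI impI)
  fix U
  obtain n where n: "\<forall>x y. seg n x = seg n y \<longrightarrow> c x = c y"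
    using assms(1) unfolding locally_constant_def by blast
  have "open (c -` U)"
    unfolding open_iff_seg vimage_def using n by (metis mem_Collect_eq)
  then show "openin (top_of_set X) {x \<in> topspace (top_of_set X). c x \<in> U}"
    unfolding openin_open by auto
qed (use assms(2) in auto)

lemma proper_G_graph_iff:
  assumes "f ` X = X"
  shows "(\<forall>(x, y)\<in>G_graph X (restrict f X). c x \<noteq> c y) \<longleftrightarrow> (\<forall>x\<in>X. f x \<noteq> x \<longrightarrow> c x \<noteq> c (f x))"
proof (intro iffI ballI impI)
  fix x assume *: "\<forall>(x, y)\<in>G_graph X (restrict f X). c x \<noteq> c y" and x: "x \<in> X" "f x \<noteq> x"
  have "(x, f x) \<in> G_graph X (restrict f X)"
    using x by (auto simp: G_graph_def graph_on_def)
  then show "c x \<noteq> c (f x)"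
    using * by blast
next
  fix e assume *: "\<forall>x\<in>X. f x \<noteq> x \<longrightarrow> c x \<noteq> c (f x)" and "e \<in> G_graph X (restrict f X)"
  then obtain x where x: "x \<in> X" "e = (x, f x) \<or> e = (f x, x)" "e \<notin> Id_on X"
    by (auto simp: G_graph_def graph_on_def)
  then have "f x \<noteq> x"
    by auto
  then have "c x \<noteq> c (f x)"
    using * x(1) by blast
  then show "case e of (x, y) \<Rightarrow> c x \<noteq> c y"
    using x(2) by auto
qed

definition monochromatic_edge :: "(cantor \<Rightarrow> nat) \<Rightarrow> (cantor set \<times> (cantor \<Rightarrow> cantor)) set" where
  "monochromatic_edge c = {p \<in> P_set. \<exists>x\<in>fst p. snd p x \<noteq> x \<and> c x = c (snd p x)}"

definition clopen_colourings :: "nat \<Rightarrow> (cantor \<Rightarrow> nat) set" where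
  "clopen_colourings k = {c \<in> locally_constant. \<forall>x. c x < k}"

text \<open>The continuous colourings of a compact set are the restrictions of the locally constant functions on
  the whole space. This requires at least one colour, as the empty set shows.\<close>

lemma O_set_eq:
  assumes "0 < k"
  shows "O_set k = (\<Inter>c\<in>clopen_colourings k. monochromatic_edge c)"
proof -
  have col: "continuously_colourable (top_of_set X) (G_graph X (restrict f X)) (enat k) \<longleftrightarrow>
      (\<exists>c\<in>clopen_colourings k. \<forall>x\<in>X. f x \<noteq> x \<longrightarrow> c x \<noteq> c (f x))"
    if "compact X" and X: "f ` X = X" for X f
  proof
    assume "continuously_colourable (top_of_set X) (G_graph X (restrict f X)) (enat k)"
    then obtain c where c: "continuous_map (top_of_set X) (discrete_topology {n. enat n < enat k}) c"
        "\<forall>x\<in>X. f x \<noteq> x \<longrightarrow> c x \<noteq> c (f x)"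
      unfolding continuously_colourable_def proper_G_graph_iff[OF X] by blast
    have "\<exists>c'\<in>locally_constant. (\<forall>x. c' x \<in> {n. enat n < enat k}) \<and> (\<forall>x\<in>X. c' x = c x)"
      by (rule continuous_on_compact_extends[OF \<open>compact X\<close> c(1), of 0]) (use assms in simp)
    then obtain c' where c': "c' \<in> locally_constant" "\<forall>x. c' x < k" "\<forall>x\<in>X. c' x = c x"
      by auto
    have "f x \<in> X" if "x \<in> X" for x
      using X that by blast
    then have "\<forall>x\<in>X. f x \<noteq> x \<longrightarrow> c' x \<noteq> c' (f x)"
      using c(2) c'(3) by simp
    then show "\<exists>c\<in>clopen_colourings k. \<forall>x\<in>X. f x \<noteq> x \<longrightarrow> c x \<noteq> c (f x)"
      using c'(1,2) unfolding clopen_colourings_def by blast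
  next
    assume "\<exists>c\<in>clopen_colourings k. \<forall>x\<in>X. f x \<noteq> x \<longrightarrow> c x \<noteq> c (f x)"
    then obtain c where c: "c \<in> locally_constant" "\<forall>x. c x < k" "\<forall>x\<in>X. f x \<noteq> x \<longrightarrow> c x \<noteq> c (f x)"
      unfolding clopen_colourings_def by blast
    have "continuous_map (top_of_set X) (discrete_topology {n. enat n < enat k}) c"
      by (rule locally_constant_continuous_map[OF c(1)]) (simp add: c(2))
    then show "continuously_colourable (top_of_set X) (G_graph X (restrict f X)) (enat k)"
      unfolding continuously_colourable_def proper_G_graph_iff[OF X] using c(3) by blast
  qed
  have "(\<lambda>_. 0) \<in> clopen_colourings k"
    using assms by (simp add: clopen_colourings_def locally_constant_def)
  then have sub: "(\<Inter>c\<in>clopen_colourings k. monochromatic_edge c) \<subseteq> P_set"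
    by (auto simp: monochromatic_edge_def)
  have "p \<in> O_set k \<longleftrightarrow> p \<in> (\<Inter>c\<in>clopen_colourings k. monochromatic_edge c)" if p: "p \<in> P_set" for p
  proof -
    obtain X f where Xf: "p = (X, f)"
      by (cases p)
    show ?thesis
      using p col[of X f] P_setD(1,3)[OF p] unfolding Xf O_set_def less_chi_c_iff monochromatic_edge_def
      by auto
  qed
  moreover have "O_set k \<subseteq> P_set"
    by (auto simp: O_set_def)
  ultimately show ?thesis
    using sub by blast
qed

text \<open>An edge with equally coloured ends is witnessed by finitely many digits of its two ends: enough to
  see that they differ and what their colours are. A nearby pair \<open>(Y, g)\<close> has a point \<open>y\<close> of \<open>Y\<close> close
  to \<open>x\<close>, with \<open>g y\<close> close to \<open>f x\<close>.\<close>

lemma openin_monochromatic_edge: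
  assumes "c \<in> locally_constant"
  shows "openin P_space (monochromatic_edge c)"
  unfolding openin_P_space_iff
proof (intro conjI ballI)
  show "monochromatic_edge c \<subseteq> P_set"
    by (auto simp: monochromatic_edge_def)
next
  fix p assume p: "p \<in> monochromatic_edge c"
  let ?f = "snd p"
  obtain x where x: "x \<in> fst p" "?f x \<noteq> x" "c x = c (?f x)"
    using p by (auto simp: monochromatic_edge_def)
  obtain n where n: "\<And>x y. seg n x = seg n y \<Longrightarrow> c x = c y"
    using assms unfolding locally_constant_def by blast
  obtain d where d: "?f x d \<noteq> x d"
    using x(2) by blast
  define m where "m = max n (Suc d)"
  have "?f \<in> homeos"
    using p by (auto simp: monochromatic_edge_def dest: P_setD(2))
  then obtain k where k: "\<And>x y. seg k x = seg k y \<Longrightarrow> seg m (?f x) = seg m (?f y)"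
    using continuous_seg_locally_constant[OF homeosD(1), of ?f m] by (auto simp: locally_constant_def)
  have "q \<in> monochromatic_edge c" if q: "q \<in> P_set" and eq: "level (max m k) q = level (max m k) p" for q
  proof -
    have "seg (max m k) x \<in> seg (max m k) ` fst q"
      using eq x(1) unfolding level_eq_iff by blast
    then obtain y where y: "y \<in> fst q" "seg (max m k) x = seg (max m k) y"
      by blast
    have ym: "seg m x = seg m y" and yk: "seg k x = seg k y"
      using seg_eq_mono[OF y(2)] by simp_all
    have "seg (max m k) (snd q y) = seg (max m k) (?f y)"
      using eq unfolding level_eq_iff by blast
    then have "seg m (snd q y) = seg m (?f y)"
      by (rule seg_eq_mono) simp
    also have "\<dots> = seg m (?f x)"
      using k[OF yk] by simp
    finally have fm: "seg m (snd q y) = seg m (?f x)" .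
    have "y d = x d" "snd q y d = ?f x d"
      using ym fm unfolding seg_eq_iff m_def by simp_all
    then have "snd q y \<noteq> y"
      using d by metis
    moreover have "c x = c y"
      by (rule n, rule seg_eq_mono[OF ym]) (simp add: m_def)
    moreover have "c (snd q y) = c (?f x)"
      by (rule n, rule seg_eq_mono[OF fm]) (simp add: m_def)
    ultimately have "snd q y \<noteq> y" "c y = c (snd q y)"
      using x(3) by simp_all
    then show ?thesis
      using q y(1) unfolding monochromatic_edge_def by blast
  qed
  then show "\<exists>m. \<forall>q\<in>P_set. level m q = level m p \<longrightarrow> q \<in> monochromatic_edge c"
    by blast
qed

lemma countable_clopen_colourings: "countable (clopen_colourings k)"
  by (rule countable_subset[OF _ countable_locally_constant]) (auto simp: clopen_colourings_def)

lemma gdelta_in_O_set: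
  assumes "0 < k"
  shows "gdelta_in P_space (O_set k)"
  unfolding O_set_eq[OF assms]
proof (rule gdelta_in_Inter)
  show "countable (monochromatic_edge ` clopen_colourings k)"
    by (intro countable_image countable_clopen_colourings)
  have "(\<lambda>_. 0) \<in> clopen_colourings k"
    using assms by (simp add: clopen_colourings_def locally_constant_def)
  then show "monochromatic_edge ` clopen_colourings k \<noteq> {}"
    by blast
  fix S assume "S \<in> monochromatic_edge ` clopen_colourings k"
  then show "gdelta_in P_space S"
    using openin_monochromatic_edge by (auto simp: clopen_colourings_def intro: open_imp_gdelta_in)
qed

lemma O_set_1: "O_set 1 = monochromatic_edge (\<lambda>_. 0)"
proof -
  have "clopen_colourings 1 = {\<lambda>_. 0}"
    by (auto simp: clopen_colourings_def locally_constant_def)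
  then show ?thesis
    by (simp add: O_set_eq)
qed

lemma openin_O_set_1: "openin P_space (O_set 1)"
  unfolding O_set_1 by (rule openin_monochromatic_edge) (simp add: locally_constant_def)

lemma O_set_0: "O_set 0 = {p \<in> P_set. fst p \<noteq> {}}"
proof -
  have "continuously_colourable (top_of_set X) (G_graph X (restrict f X)) (enat 0) \<longleftrightarrow> X = {}"
    for X :: "cantor set" and f
    unfolding continuously_colourable_def continuous_map_def
    by (auto simp: Pi_iff G_graph_def graph_on_def)
  then show ?thesis
    by (auto simp: O_set_def less_chi_c_iff)
qed

lemma clopen_O_set_0: "clopen_in P_space (O_set 0)"
proof -
  have empty: "fst p = {} \<longleftrightarrow> fst q = {}" if "level 0 p = level 0 q" for p q
  proof -
    have "seg 0 ` fst p = {} \<longleftrightarrow> seg 0 ` fst q = {}"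
      using that unfolding level_eq_iff by simp
    then show ?thesis
      by simp
  qed
  have "openin P_space {p \<in> P_set. fst p \<noteq> {}}"
    unfolding openin_P_space_iff
  proof (intro conjI ballI exI[of _ 0] impI)
    fix p q assume "p \<in> {p \<in> P_set. fst p \<noteq> {}}" "q \<in> P_set" "level 0 q = level 0 p"
    then show "q \<in> {p \<in> P_set. fst p \<noteq> {}}"
      using empty[of q p] by simp
  qed simp
  moreover have "openin P_space {p \<in> P_set. fst p = {}}"
    unfolding openin_P_space_iff
  proof (intro conjI ballI exI[of _ 0] impI)
    fix p q assume "p \<in> {p \<in> P_set. fst p = {}}" "q \<in> P_set" "level 0 q = level 0 p"
    then show "q \<in> {p \<in> P_set. fst p = {}}"
      using empty[of q p] by simp
  qed simp
  moreover have "P_set - {p \<in> P_set. fst p \<noteq> {}} = {p \<in> P_set. fst p = {}}"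
    by blast
  ultimately show ?thesis
    by (auto simp: clopen_in_def closedin_def topspace_P_space O_set_0)
qed

section \<open>Flips\<close>

definition first_true :: "cantor \<Rightarrow> nat \<Rightarrow> bool" where
  "first_true x i \<longleftrightarrow> x i \<and> (\<forall>j<i. \<not> x j)"

definition flip :: "(nat \<Rightarrow> bool) \<Rightarrow> cantor \<Rightarrow> cantor" where
  "flip \<alpha> x = (\<lambda>k. if \<exists>i. k = Suc i \<and> \<alpha> i \<and> first_true x i then \<not> x k else x k)"

lemma first_true_unique: "first_true x i \<Longrightarrow> first_true x j \<Longrightarrow> i = j"
  unfolding first_true_def by (meson linorder_neqE_nat)

lemma flip_Suc: "first_true x i \<Longrightarrow> \<alpha> i \<Longrightarrow> flip \<alpha> x (Suc i) \<longleftrightarrow> \<not> x (Suc i)"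
  by (auto simp: flip_def)

lemma flip_other:
  assumes "first_true x i" "k \<noteq> Suc i"
  shows "flip \<alpha> x k = x k"
proof -
  have "\<not> (\<exists>j. k = Suc j \<and> \<alpha> j \<and> first_true x j)"
    using assms first_true_unique by blast
  then show ?thesis
    unfolding flip_def by (rule if_not_P)
qed

lemma flip_inactive: "(\<And>i. first_true x i \<Longrightarrow> \<not> \<alpha> i) \<Longrightarrow> flip \<alpha> x = x"
  by (auto simp: flip_def fun_eq_iff)

lemma flip_neq_iff: "flip \<alpha> x \<noteq> x \<longleftrightarrow> (\<exists>i. first_true x i \<and> \<alpha> i)"
proof
  assume "flip \<alpha> x \<noteq> x"
  then show "\<exists>i. first_true x i \<and> \<alpha> i"
    using flip_inactive by blast
next
  assume "\<exists>i. first_true x i \<and> \<alpha> i"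
  then obtain i where "first_true x i" "\<alpha> i"
    by blast
  from flip_Suc[of x i \<alpha>, OF this] show "flip \<alpha> x \<noteq> x"
    by auto
qed

text \<open>The negated digit lies behind the first \<open>True\<close>, so the latter is not affected; this is why
  \<open>flip \<alpha>\<close> is an involution.\<close>

lemma first_true_flip: "first_true (flip \<alpha> x) i \<longleftrightarrow> first_true x i"
proof (cases "\<exists>j. first_true x j")
  case True
  then obtain j where j: "first_true x j"
    by blast
  have "flip \<alpha> x k = x k" if "k \<le> j" for k
    using flip_other[OF j] that by simp
  then have "first_true (flip \<alpha> x) j"
    using j by (simp add: first_true_def)
  then show ?thesis
    using j first_true_unique by blast
next
  case False
  then have "flip \<alpha> x = x"
    by (intro flip_inactive) blast
  then show ?thesis
    by simp
qed

lemma flip_flip: "flip \<alpha> (flip \<alpha> x) = x"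
proof
  fix k
  have "flip \<alpha> (flip \<alpha> x) k =
      (if \<exists>i. k = Suc i \<and> \<alpha> i \<and> first_true x i then \<not> flip \<alpha> x k else flip \<alpha> x k)"
    by (simp only: flip_def[of \<alpha> "flip \<alpha> x"] first_true_flip)
  then show "flip \<alpha> (flip \<alpha> x) k = x k"
    by (simp only: flip_def[of \<alpha> x] split: if_split) blast
qed

lemma seg_flip:
  assumes "\<forall>i<m. \<alpha> i = \<beta> i" "seg m x = seg m y"
  shows "seg m (flip \<alpha> x) = seg m (flip \<beta> y)"
proof -
  have "first_true x i = first_true y i" if "i < m" for i
    using assms(2) that by (simp add: seg_eq_iff first_true_def)
  then have eq: "(\<exists>i. k = Suc i \<and> \<alpha> i \<and> first_true x i) \<longleftrightarrow> (\<exists>i. k = Suc i \<and> \<beta> i \<and> first_true y i)"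
    if "k < m" for k
    using assms(1) that by auto
  show ?thesis
    unfolding seg_eq_iff
  proof (intro allI impI)
    fix k assume k: "k < m"
    then have "x k = y k"
      using assms(2) by (simp add: seg_eq_iff)
    then show "flip \<alpha> x k = flip \<beta> y k"
      unfolding flip_def eq[OF k] by (simp only:)
  qed
qed

lemma flip_homeo: "flip \<alpha> \<in> homeos" "inv (flip \<alpha>) = flip \<alpha>"
proof -
  have "continuous_on UNIV (flip \<alpha>)"
  proof (rule continuous_if_seg_locally_constant)
    fix m
    show "seg m \<circ> flip \<alpha> \<in> locally_constant"
      unfolding locally_constant_def comp_apply using seg_flip[of m \<alpha> \<alpha>] by blast
  qed
  then show "flip \<alpha> \<in> homeos" "inv (flip \<alpha>) = flip \<alpha>"
    using homeosI[of "flip \<alpha>" "flip \<alpha>"] flip_flip by blast+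
qed

text \<open>The sequence with its only \<open>True\<close> at a position \<open>i\<close> where \<open>\<alpha>\<close> holds is an end of an edge whose
  two ends agree up to \<open>i\<close>. So these edges shrink to the point \<open>\<lambda>_. False\<close>, and a locally constant \<open>c\<close>
  cannot separate the ends of all of them.\<close>

lemma flip_monochromatic:
  assumes "infinite {i. \<alpha> i}" "(X, flip \<alpha>) \<in> P_set" "\<And>i. (\<lambda>k. k = i) \<in> X" "c \<in> locally_constant"
  shows "(X, flip \<alpha>) \<in> monochromatic_edge c"
proof -
  obtain n where n: "\<And>x y. seg n x = seg n y \<Longrightarrow> c x = c y"
    using assms(4) unfolding locally_constant_def by blast
  obtain i where i: "n \<le> i" "\<alpha> i"
    using assms(1) unfolding infinite_nat_iff_unbounded_le by blast
  let ?x = "\<lambda>k. k = i"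
  have x: "first_true ?x i"
    by (simp add: first_true_def)
  have "seg n ?x = seg n (flip \<alpha> ?x)"
    unfolding seg_eq_iff using i(1) flip_other[OF x] by simp
  then have "c ?x = c (flip \<alpha> ?x)"
    by (rule n)
  moreover have "flip \<alpha> ?x \<noteq> ?x"
    unfolding flip_neq_iff using x i(2) by blast
  ultimately show ?thesis
    using assms(2,3) unfolding monochromatic_edge_def by auto
qed

lemma flip_in_O_set:
  assumes "infinite {i. \<alpha> i}" "(X, flip \<alpha>) \<in> P_set" "\<And>i. (\<lambda>k. k = i) \<in> X" "0 < k"
  shows "(X, flip \<alpha>) \<in> O_set k"
  unfolding O_set_eq[OF \<open>0 < k\<close>] using flip_monochromatic[OF assms(1,2,3)]
  by (auto simp: clopen_colourings_def)

text \<open>The two colours are the values of the digit that is negated, where \<open>\<alpha>\<close> holds. As \<open>\<alpha>\<close> holds at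
  finitely many positions only, this depends on a bounded number of digits.\<close>

lemma flip_not_in_O_set:
  assumes "finite {i. \<alpha> i}" "2 \<le> k"
  shows "(X, flip \<alpha>) \<notin> O_set k"
proof -
  obtain N where N: "\<And>i. \<alpha> i \<Longrightarrow> i < N"
    using assms(1) unfolding finite_nat_set_iff_bounded by auto
  define c where "c x = (if \<exists>i<N. \<alpha> i \<and> first_true x i \<and> x (Suc i) then 1 else 0 :: nat)" for x
  have "c x = c y" if "seg (Suc N) x = seg (Suc N) y" for x y
  proof -
    have "first_true x i = first_true y i \<and> x (Suc i) = y (Suc i)" if "i < N" for i
      using \<open>seg (Suc N) x = seg (Suc N) y\<close> that by (simp add: seg_eq_iff first_true_def)
    then show ?thesis
      unfolding c_def by metis
  qed
  then have "c \<in> locally_constant"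
    unfolding locally_constant_def by blast
  moreover have "c x < k" for x
    using assms(2) by (simp add: c_def)
  ultimately have "c \<in> clopen_colourings k"
    by (simp add: clopen_colourings_def)
  moreover have "(X, flip \<alpha>) \<notin> monochromatic_edge c"
  proof
    assume "(X, flip \<alpha>) \<in> monochromatic_edge c"
    then obtain x where x: "flip \<alpha> x \<noteq> x" "c x = c (flip \<alpha> x)"
      by (auto simp: monochromatic_edge_def)
    obtain i where i: "first_true x i" "\<alpha> i"
      using x(1) unfolding flip_neq_iff by blast
    have c: "c y = (if y (Suc i) then 1 else 0)" if "first_true y i" for y
    proof -
      have "(\<exists>j<N. \<alpha> j \<and> first_true y j \<and> y (Suc j)) \<longleftrightarrow> y (Suc i)"
        using that i(2) N[OF i(2)] first_true_unique by blast
      then show ?thesis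
        unfolding c_def by simp
    qed
    have "c x \<noteq> c (flip \<alpha> x)"
      using c[OF i(1)] c[of "flip \<alpha> x"] first_true_flip[of \<alpha> x i] flip_Suc[of x i \<alpha>] i by simp
    then show False
      using x(2) by simp
  qed
  ultimately show ?thesis
    using assms(2) by (auto simp: O_set_eq)
qed

lemma UNIV_flip_in_P_set: "(UNIV, flip \<alpha>) \<in> P_set"
  using compact_cantor flip_homeo(1) bij_is_surj[OF homeosD(3)[OF flip_homeo(1)]]
  by (auto simp: P_set_def)

lemma flip_in_O_set_1_iff: "(UNIV, flip \<alpha>) \<in> O_set 1 \<longleftrightarrow> (\<exists>i. \<alpha> i)"
proof -
  have "first_true (\<lambda>k. k = i) i" for i
    by (simp add: first_true_def)
  then show ?thesis
    unfolding O_set_1 monochromatic_edge_def using UNIV_flip_in_P_set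
    by (auto simp: flip_neq_iff)
qed

lemma continuous_flip_code:
  assumes "\<And>i::nat. clopen_in Z (W i)"
  shows "continuous_map Z P_space (\<lambda>z. (UNIV, flip (\<lambda>i. z \<in> W i)))"
proof (rule continuous_into_P_space[OF assms])
  fix m z z'
  assume "\<forall>i<m. z \<in> W i \<longleftrightarrow> z' \<in> W i"
  then show "level m (UNIV, flip (\<lambda>i. z \<in> W i)) = level m (UNIV, flip (\<lambda>i. z' \<in> W i))"
    unfolding level_eq_iff fst_conv snd_conv flip_homeo(2) by (auto intro!: seg_flip)
qed (rule UNIV_flip_in_P_set)

section \<open>Completeness of the sets of low complexity\<close>

text \<open>A countable base is provided by the balls of radius \<open>1 / Suc n\<close> around the points of a countable
  dense set; choose one clopen set between such a ball and \<open>U\<close> whenever there is one.\<close>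

lemma openin_countable_Union_clopen:
  assumes "polish Z" "zero_dimensional Z" "openin Z U"
  shows "\<exists>V :: nat \<Rightarrow> _. (\<forall>i. clopen_in Z (V i)) \<and> (\<Union>i. V i) = U"
proof -
  obtain M d where M: "Metric_space M d" and Z: "Z = Metric_space.mtopology M d"
    using assms(1) unfolding polish_def completely_metrizable_space_def by blast
  interpret Metric_space M d
    by (rule M)
  obtain D where D: "countable D" "D \<subseteq> M" "mtopology closure_of D = M"
    using assms(1) unfolding polish_def separable_space_def Z by auto
  define good where "good = {(a, n :: nat). a \<in> D \<and> (\<exists>W. clopen_in Z W \<and> mball a (1 / Suc n) \<subseteq> W \<and> W \<subseteq> U)}"
  define W where "W p = (SOME W. clopen_in Z W \<and> mball (fst p) (1 / Suc (snd p)) \<subseteq> W \<and> W \<subseteq> U)" for p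
  have W: "clopen_in Z (W p) \<and> mball (fst p) (1 / Suc (snd p)) \<subseteq> W p \<and> W p \<subseteq> U" if "p \<in> good" for p
    unfolding W_def by (rule someI_ex) (use that in \<open>auto simp: good_def\<close>)
  have "good \<subseteq> D \<times> UNIV"
    by (auto simp: good_def)
  then have "countable good"
    using D(1) by (meson countable_SIGMA countable_subset countableI_type)
  have "U \<subseteq> (\<Union>p\<in>good. W p)"
  proof
    fix x assume x: "x \<in> U"
    obtain V where V: "clopen_in Z V" "x \<in> V" "V \<subseteq> U"
      using assms(2,3) x unfolding zero_dimensional_def neighbourhood_base_of clopen_in_def by blast
    then obtain r where r: "r > 0" "mball x r \<subseteq> V"
      unfolding clopen_in_def Z openin_mtopology by blast
    obtain n :: nat where n: "1 / Suc n < r / 2"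
      using r(1) by (metis half_gt_zero nat_approx_posE)
    have "x \<in> M"
      using V(1,2) openin_subset[of Z V] unfolding clopen_in_def Z by auto
    then have "x \<in> mtopology closure_of D"
      using D(3) by simp
    then obtain a where a: "a \<in> D" "a \<in> mball x (1 / Suc n)"
      unfolding metric_closure_of by (auto dest: spec[of _ "1 / Suc n"])
    have "mball a (1 / Suc n) \<subseteq> mball x r"
    proof
      fix y assume y: "y \<in> mball a (1 / Suc n)"
      have "d x y \<le> d x a + d a y"
        using y a(2) by (intro triangle) auto
      also have "\<dots> < r"
        using y a(2) n by simp
      finally show "y \<in> mball x r"
        using y a(2) by simp
    qed
    then have "mball a (1 / Suc n) \<subseteq> V"
      using r(2) by blast
    then have good: "(a, n) \<in> good"
      using a(1) V unfolding good_def by blast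
    have "x \<in> mball a (1 / Suc n)"
      using a(2) by (simp add: commute)
    then show "x \<in> (\<Union>p\<in>good. W p)"
      using good W[OF good] by auto
  qed
  then have U: "U = (\<Union>p\<in>good. W p)"
    using W by blast
  show ?thesis
  proof (cases "good = {}")
    case True
    then show ?thesis
      using U by (intro exI[of _ "\<lambda>_. {}"]) (simp add: clopen_in_def)
  next
    case False
    show ?thesis
    proof (intro exI[of _ "\<lambda>i. W (from_nat_into good i)"] conjI allI)
      show "clopen_in Z (W (from_nat_into good i))" for i
        using W from_nat_into[OF False] by blast
      have "range (from_nat_into good) = good"
        by (rule range_from_nat_into[OF False \<open>countable good\<close>])
      then show "(\<Union>i. W (from_nat_into good i)) = U"
        unfolding U by (metis image_image)
    qed
  qed
qed

theorem Sigma01_complete_O_set_1: "Sigma01_complete TYPE('z) P_space (O_set 1)"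
  unfolding Sigma01_complete_def class_complete_def
proof (intro conjI allI impI openin_O_set_1)
  fix Z :: "'z topology" and C
  assume Z: "polish Z \<and> zero_dimensional Z \<and> openin Z C"
  then obtain W where W: "\<And>i::nat. clopen_in Z (W i)" "(\<Union>i. W i) = C"
    using openin_countable_Union_clopen by blast
  have "C = {z \<in> topspace Z. (UNIV, flip (\<lambda>i. z \<in> W i)) \<in> O_set 1}"
    unfolding flip_in_O_set_1_iff using W(2) openin_subset[of Z C] Z by auto
  moreover have "continuous_map Z P_space (\<lambda>z. (UNIV, flip (\<lambda>i. z \<in> W i)))"
    by (rule continuous_flip_code) (rule W(1))
  ultimately show "\<exists>f. continuous_map Z P_space f \<and> C = {z \<in> topspace Z. f z \<in> O_set 1}"
    by (intro exI conjI)
qed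

text \<open>Let \<open>C\<close> be the intersection of decreasing open sets \<open>U n\<close>, each of which is the union of clopen
  sets \<open>V n j\<close>. Each \<open>U n\<close> that contains \<open>z\<close> is counted once, at the pair of \<open>n\<close> and the least \<open>j\<close> with
  \<open>z \<in> V n j\<close>; since the \<open>U n\<close> decrease, infinitely many of them contain \<open>z\<close> iff all do.\<close>

lemma gdelta_in_infinitely_often:
  assumes "polish Z" "zero_dimensional Z" "gdelta_in Z C"
  shows "\<exists>W :: nat \<Rightarrow> _. (\<forall>i. clopen_in Z (W i)) \<and> C = {z \<in> topspace Z. infinite {i. z \<in> W i}}"
proof -
  obtain U where U: "\<And>n. openin Z (U n)" "\<And>n. U (Suc n) \<subseteq> U n" "(\<Inter>n. U n) = C"
    using assms(3) unfolding gdelta_in_descending by auto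
  have "\<exists>V :: nat \<Rightarrow> _. (\<forall>i. clopen_in Z (V i)) \<and> (\<Union>i. V i) = U n" for n
    by (rule openin_countable_Union_clopen[OF assms(1,2) U(1)])
  then obtain V where "\<forall>n. (\<forall>i::nat. clopen_in Z (V n i)) \<and> (\<Union>i. V n i) = U n"
    using choice[of "\<lambda>n V. (\<forall>i::nat. clopen_in Z (V i)) \<and> (\<Union>i. V i) = U n"] by blast
  then have V: "clopen_in Z (V n i)" "(\<Union>i. V n i) = U n" for n i
    by blast+
  define W where "W = (\<lambda>k. case prod_decode k of (n, j) \<Rightarrow> V n j - (\<Union>i<j. V n i))"
  have clopen: "clopen_in Z (V n j - (\<Union>i<j. V n i))" for n j
    using V(1) unfolding clopen_in_def by (intro conjI openin_diff closedin_diff closedin_Union) auto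
  have W: "clopen_in Z (W k)" for k
    unfolding W_def using clopen by (simp split: prod.split)
  have "{k. z \<in> W k} = (\<lambda>n. prod_encode (n, LEAST j. z \<in> V n j)) ` {n. z \<in> U n}" for z
  proof (intro subset_antisym subsetI)
    fix k assume "k \<in> {k. z \<in> W k}"
    moreover obtain n j where k: "k = prod_encode (n, j)"
      by (metis prod_decode_inverse surj_pair)
    ultimately have z: "z \<in> V n j" "\<And>i. i < j \<Longrightarrow> z \<notin> V n i"
      by (auto simp: W_def)
    then have "(LEAST j. z \<in> V n j) = j"
      by (intro Least_equality) (auto simp: not_less[symmetric])
    moreover have "z \<in> U n"
      using z(1) V(2) by blast
    ultimately show "k \<in> (\<lambda>n. prod_encode (n, LEAST j. z \<in> V n j)) ` {n. z \<in> U n}"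
      using k by blast
  next
    fix k assume "k \<in> (\<lambda>n. prod_encode (n, LEAST j. z \<in> V n j)) ` {n. z \<in> U n}"
    then obtain n where n: "z \<in> U n" "k = prod_encode (n, LEAST j. z \<in> V n j)"
      by blast
    have "\<exists>j. z \<in> V n j"
      using n(1) V(2) by blast
    then have "z \<in> V n (LEAST j. z \<in> V n j)"
      by (rule LeastI_ex)
    then show "k \<in> {k. z \<in> W k}"
      using not_less_Least n(2) by (auto simp: W_def)
  qed
  moreover have "inj_on (\<lambda>n. prod_encode (n, LEAST j. z \<in> V n j)) {n. z \<in> U n}" for z
    by (rule inj_onI) simp
  ultimately have inf: "infinite {k. z \<in> W k} \<longleftrightarrow> infinite {n. z \<in> U n}" for z
    by (simp add: finite_image_iff)
  have dec: "U n \<subseteq> U m" if "m \<le> n" for m n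
    using that U(2) by (metis lift_Suc_antimono_le)
  have "z \<in> C \<longleftrightarrow> z \<in> topspace Z \<and> infinite {n. z \<in> U n}" for z
  proof
    assume "z \<in> C"
    then have "z \<in> U n" for n
      using U(3) by blast
    then show "z \<in> topspace Z \<and> infinite {n. z \<in> U n}"
      using openin_subset[OF U(1)] by auto
  next
    assume "z \<in> topspace Z \<and> infinite {n. z \<in> U n}"
    then have "z \<in> U m" for m
      unfolding infinite_nat_iff_unbounded_le using dec by blast
    then show "z \<in> C"
      using U(3) by blast
  qed
  then have "C = {z \<in> topspace Z. infinite {k. z \<in> W k}}"
    unfolding inf by blast
  then show ?thesis
    using W by (intro exI[of _ W] conjI allI)
qed

theorem Pi02_complete_O_set:
  assumes "2 \<le> k"
  shows "Pi02_complete TYPE('z) P_space (O_set k)"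
  unfolding Pi02_complete_def class_complete_def
proof (intro conjI allI impI)
  show "gdelta_in P_space (O_set k)"
    using assms by (intro gdelta_in_O_set) simp
  fix Z :: "'z topology" and C
  assume "polish Z \<and> zero_dimensional Z \<and> gdelta_in Z C"
  then obtain W where W: "\<And>i::nat. clopen_in Z (W i)" "C = {z \<in> topspace Z. infinite {i. z \<in> W i}}"
    using gdelta_in_infinitely_often by blast
  have "(UNIV, flip \<alpha>) \<in> O_set k \<longleftrightarrow> infinite {i. \<alpha> i}" for \<alpha>
    using flip_in_O_set[of \<alpha> UNIV k] flip_not_in_O_set[of \<alpha> k] UNIV_flip_in_P_set assms by auto
  then have "C = {z \<in> topspace Z. (UNIV, flip (\<lambda>i. z \<in> W i)) \<in> O_set k}"
    using W(2) by simp
  moreover have "continuous_map Z P_space (\<lambda>z. (UNIV, flip (\<lambda>i. z \<in> W i)))"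
    by (rule continuous_flip_code) (rule W(1))
  ultimately show "\<exists>f. continuous_map Z P_space f \<and> C = {z \<in> topspace Z. f z \<in> O_set k}"
    by (intro exI conjI)
qed

section \<open>Countability is co-analytic\<close>

lemma analytic_in_closedin:
  assumes "closedin X A"
  shows "analytic_in X A"
  unfolding analytic_in_def
proof (intro exI conjI)
  show "closedin (prod_topology X (euclidean :: (nat \<Rightarrow> nat) topology)) (A \<times> UNIV)"
    using assms by (simp add: closedin_prod_Times_iff)
qed simp

text \<open>A witness for the union puts in front of a witness for \<open>A n\<close> the index \<open>n\<close>. The resulting set is
  closed because its complement splits along the clopen condition on the first entry.\<close>

lemma analytic_in_UN:
  assumes "\<And>n::nat. analytic_in X (A n)"
  shows "analytic_in X (\<Union>n. A n)"
proof -
  let ?P = "prod_topology X (euclidean :: (nat \<Rightarrow> nat) topology)"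
  let ?T = "\<lambda>p :: 'a \<times> (nat \<Rightarrow> nat). (fst p, snd p \<circ> Suc)"
  have "\<forall>n. \<exists>F. closedin ?P F \<and> A n = fst ` F"
    using assms unfolding analytic_in_def by blast
  then obtain F where "\<forall>n. closedin ?P (F n) \<and> A n = fst ` F n"
    using choice[of "\<lambda>n F. closedin ?P F \<and> A n = fst ` F"] by blast
  then have F: "closedin ?P (F n)" "A n = fst ` F n" for n
    by blast+
  have sub: "F n \<subseteq> topspace ?P" for n
    using F(1) closedin_subset by blast
  have "continuous_on UNIV (\<lambda>w :: nat \<Rightarrow> nat. w \<circ> Suc)"
    unfolding comp_def by (intro continuous_on_coordinatewise_then_product continuous_on_product_coordinates)
  then have "continuous_map ?P euclidean ((\<lambda>w. w \<circ> Suc) \<circ> snd)"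
    by (intro continuous_map_compose[OF continuous_map_snd]) simp
  then have T: "continuous_map ?P ?P ?T"
    by (intro continuous_map_pairedI continuous_map_fst) (simp add: comp_def)
  define G where "G n = {p \<in> topspace ?P. ?T p \<in> F n}" for n
  define H where "H n = {p \<in> topspace ?P. snd p \<in> {w. seg 1 w = [n]}}" for n
  have G: "closedin ?P (G n)" for n
    unfolding G_def by (rule closedin_continuous_map_preimage[OF T F(1)])
  have H: "openin ?P (H n)" for n
    unfolding H_def
    by (rule openin_continuous_map_preimage[OF continuous_map_snd]) (simp add: open_seg)
  define F' where "F' = {p \<in> topspace ?P. ?T p \<in> F (snd p 0)}"
  have "topspace ?P - F' = (\<Union>n. H n - G n)"
    by (auto simp: F'_def H_def G_def seg_def)
  moreover have "openin ?P (\<Union>n. H n - G n)"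
    using G H by (intro openin_Union) (auto intro: openin_diff)
  ultimately have "closedin ?P F'"
    unfolding closedin_def by (auto simp: F'_def)
  moreover have "(\<Union>n. A n) = fst ` F'"
  proof (intro subset_antisym subsetI)
    fix x assume "x \<in> (\<Union>n. A n)"
    then obtain n w where xw: "(x, w) \<in> F n"
      using F(2) by fastforce
    then have "x \<in> topspace X"
      using sub[of n] by auto
    then have "(x, case_nat n w) \<in> F'"
      using xw by (simp add: F'_def comp_def)
    then show "x \<in> fst ` F'"
      by force
  next
    fix x assume "x \<in> fst ` F'"
    then obtain w where "(x, w \<circ> Suc) \<in> F (w 0)"
      by (auto simp: F'_def)
    then show "x \<in> (\<Union>n. A n)"
      unfolding F(2) by force
  qed
  ultimately show ?thesis
    unfolding analytic_in_def by blast
qed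

lemma closedin_P_space_times:
  fixes F :: "(_ \<times> (nat \<Rightarrow> nat)) set"
  assumes "F \<subseteq> P_set \<times> UNIV"
    and "\<And>p w. p \<in> P_set \<Longrightarrow> (p, w) \<notin> F \<Longrightarrow>
      \<exists>m n. \<forall>q\<in>P_set. \<forall>v. level m q = level m p \<and> seg n v = seg n w \<longrightarrow> (q, v) \<notin> F"
  shows "closedin (prod_topology P_space euclidean) F"
proof -
  let ?P = "prod_topology P_space (euclidean :: (nat \<Rightarrow> nat) topology)"
  have top: "topspace ?P = P_set \<times> UNIV"
    by (simp add: topspace_P_space)
  have "\<exists>T. openin ?P T \<and> e \<in> T \<and> T \<subseteq> P_set \<times> UNIV - F" if e: "e \<in> P_set \<times> UNIV - F" for e
  proof -
    obtain p w where pw: "e = (p, w)"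
      by (cases e)
    have p: "p \<in> P_set" "(p, w) \<notin> F"
      using e pw by auto
    obtain m n where mn: "\<forall>q\<in>P_set. \<forall>v. level m q = level m p \<and> seg n v = seg n w \<longrightarrow> (q, v) \<notin> F"
      using assms(2)[OF p] by blast
    have "openin P_space {q \<in> P_set. level m q = level m p}"
      unfolding openin_P_space_iff by (intro conjI ballI exI[of _ m] impI) auto
    then have "openin ?P ({q \<in> P_set. level m q = level m p} \<times> {v. seg n v = seg n w})"
      unfolding openin_prod_Times_iff using open_seg[of n "seg n w"] by simp
    then show ?thesis
      using mn p(1) unfolding pw by (intro exI conjI) auto
  qed
  then have "openin ?P (P_set \<times> UNIV - F)"
    by (subst openin_subopen) blast
  then show ?thesis
    using assms(1) unfolding closedin_def top by blast
qed

lemma uncountable_cantor: "uncountable (UNIV :: cantor set)"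
proof
  assume "countable (UNIV :: cantor set)"
  define e where "e = from_nat_into (UNIV :: cantor set)"
  have e: "range e = UNIV"
    unfolding e_def by (rule range_from_nat_into) (use \<open>countable UNIV\<close> in simp_all)
  have "(\<lambda>n. \<not> e n n) \<in> range e"
    unfolding e by simp
  then obtain k where k: "(\<lambda>n. \<not> e n n) = e k"
    by blast
  show False
    using fun_cong[OF k, of k] by simp
qed

text \<open>A set of segments in \<open>X\<close>, namely those with \<open>\<sigma> s \<noteq> None\<close>, in which each one has two
  incompatible extensions, which \<open>\<sigma>\<close> selects: in short, a perfect subtree with witnesses. The
  requirements are local in \<open>\<sigma>\<close>, so that they define a closed set of codes.\<close>

definition splitting_scheme :: "cantor set \<Rightarrow> (bool list \<Rightarrow> (bool list \<times> bool list) option) \<Rightarrow> bool" where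
  "splitting_scheme X \<sigma> \<longleftrightarrow> \<sigma> [] \<noteq> None \<and>
     (\<forall>s u v. \<sigma> s = Some (u, v) \<longrightarrow>
        s \<in> seg (length s) ` X \<and> take (length s) u = s \<and> take (length s) v = s \<and>
        length u = length v \<and> u \<noteq> v \<and> \<sigma> u \<noteq> None \<and> \<sigma> v \<noteq> None)"

lemma splitting_schemeD:
  assumes "splitting_scheme X \<sigma>" "\<sigma> s = Some (u, v)"
  shows "s \<in> seg (length s) ` X" "take (length s) u = s" "take (length s) v = s"
    "length u = length v" "u \<noteq> v" "\<sigma> u \<noteq> None" "\<sigma> v \<noteq> None" "length s < length u"
proof -
  show *: "s \<in> seg (length s) ` X" "take (length s) u = s" "take (length s) v = s"
    "length u = length v" "u \<noteq> v" "\<sigma> u \<noteq> None" "\<sigma> v \<noteq> None"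
    using assms unfolding splitting_scheme_def by blast+
  show "length s < length u"
  proof (rule ccontr)
    assume "\<not> length s < length u"
    then have "u = s" "v = s"
      using *(2,3,4) by simp_all
    then show False
      using *(5) by simp
  qed
qed

primrec scheme_branch :: "(bool list \<Rightarrow> (bool list \<times> bool list) option) \<Rightarrow> cantor \<Rightarrow> nat \<Rightarrow> bool list" where
  "scheme_branch \<sigma> b 0 = []"
| "scheme_branch \<sigma> b (Suc n) = (if b n then fst else snd) (the (\<sigma> (scheme_branch \<sigma> b n)))"

text \<open>Following \<open>b\<close> through the scheme yields a point \<open>z b\<close> of \<open>X\<close>. Where \<open>b\<close> and \<open>b'\<close> first differ, the two
  branches pass to different segments of the same length, so \<open>z\<close> is injective.\<close>

lemma scheme_uncountable:
  assumes "closed X" and \<sigma>: "splitting_scheme X \<sigma>"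
  shows "uncountable X"
proof -
  let ?br = "scheme_branch \<sigma>"
  have some: "\<sigma> (?br b n) \<noteq> None" for b n
  proof (induction n)
    case 0
    then show ?case
      using \<sigma> by (simp add: splitting_scheme_def)
  next
    case (Suc n)
    then obtain u v where uv: "\<sigma> (?br b n) = Some (u, v)"
      by auto
    then show ?case
      using splitting_schemeD(6,7)[OF \<sigma> uv] by simp
  qed
  have step: "take (length (?br b n)) (?br b (Suc n)) = ?br b n"
    "length (?br b n) < length (?br b (Suc n))" for b n
  proof -
    obtain u v where uv: "\<sigma> (?br b n) = Some (u, v)"
      using some[of b n] by auto
    note D = splitting_schemeD[OF \<sigma> uv]
    show "take (length (?br b n)) (?br b (Suc n)) = ?br b n" "length (?br b n) < length (?br b (Suc n))"
      using uv D(2,3,4,8) by simp_all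
  qed
  have len: "n \<le> length (?br b n)" for b n
  proof (induction n)
    case (Suc n)
    then show ?case
      using step(2)[of b n] by (simp only: Suc_le_eq)
  qed simp
  have coh: "take (length (?br b i)) (?br b j) = ?br b i \<and> length (?br b i) \<le> length (?br b j)" if "i \<le> j" for b i j
    using that
  proof (induction j rule: dec_induct)
    case (step n)
    have "take (length (?br b i)) (?br b (Suc n)) = take (length (?br b i)) (take (length (?br b n)) (?br b (Suc n)))"
      using step.IH by (simp only: take_take min.absorb1)
    also have "\<dots> = ?br b i"
      unfolding \<open>\<And>n b. take (length (?br b n)) (?br b (Suc n)) = ?br b n\<close> using step.IH by blast
    finally show ?case
      using step.IH \<open>\<And>n b. length (?br b n) < length (?br b (Suc n))\<close>[of b n] by (meson le_trans less_imp_le)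
  qed simp
  define z where "z b = (\<lambda>k. ?br b (Suc k) ! k)" for b
  have seg_z: "seg (length (?br b i)) (z b) = ?br b i" for b i
  proof (rule nth_equalityI)
    fix k assume "k < length (seg (length (?br b i)) (z b))"
    then have k: "k < length (?br b i)"
      by simp
    have k': "k < length (?br b (Suc k))"
      using len[of "Suc k" b] by simp
    have "?br b (Suc k) ! k = ?br b i ! k"
    proof (cases "Suc k \<le> i")
      case True
      then show ?thesis
        using coh[OF True, of b] k' by (metis nth_take)
    next
      case False
      then have "i \<le> Suc k"
        by simp
      then show ?thesis
        using coh[of i "Suc k" b] k by (metis nth_take)
    qed
    then show "seg (length (?br b i)) (z b) ! k = ?br b i ! k"
      using k by (simp add: seg_def z_def)
  qed simp
  have "z b \<in> X" for b
  proof (rule closed_cantorD[OF \<open>closed X\<close>])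
    fix m
    obtain u v where uv: "\<sigma> (?br b m) = Some (u, v)"
      using some[of b m] by auto
    obtain x where x: "x \<in> X" "?br b m = seg (length (?br b m)) x"
      using splitting_schemeD(1)[OF \<sigma> uv] by blast
    then have "seg (length (?br b m)) (z b) = seg (length (?br b m)) x"
      using seg_z by simp
    then have "seg m (z b) = seg m x"
      by (rule seg_eq_mono) (rule len)
    then show "seg m (z b) \<in> seg m ` X"
      using x(1) by simp
  qed
  moreover have "inj z"
  proof (rule injI, rule ccontr)
    fix b b' assume eq: "z b = z b'" and "b \<noteq> b'"
    then have "\<exists>n. b n \<noteq> b' n"
      by blast
    define n where "n = (LEAST n. b n \<noteq> b' n)"
    have n: "b n \<noteq> b' n" "\<And>k. k < n \<Longrightarrow> b k = b' k"
      unfolding n_def using LeastI_ex[OF \<open>\<exists>n. b n \<noteq> b' n\<close>] not_less_Least by blast+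
    have "k \<le> n \<Longrightarrow> ?br b k = ?br b' k" for k
      by (induction k) (use n(2) in auto)
    then have same: "?br b n = ?br b' n"
      by simp
    obtain u v where uv: "\<sigma> (?br b n) = Some (u, v)"
      using some[of b n] by auto
    have "?br b (Suc n) \<noteq> ?br b' (Suc n)" "length (?br b (Suc n)) = length (?br b' (Suc n))"
      using n(1) uv same splitting_schemeD(4,5)[OF \<sigma> uv] by auto
    then show False
      using seg_z[of b "Suc n"] seg_z[of b' "Suc n"] eq by metis
  qed
  ultimately show ?thesis
    using uncountable_cantor by (metis countable_image_inj_on countable_subset image_subset_iff)
qed

lemma uncountable_imp_nonempty: "uncountable A \<Longrightarrow> \<exists>x. x \<in> A"
  using countable_empty ex_in_conv by metis

text \<open>Discarding the countably many cylinders that meet \<open>X\<close> in a countable set leaves uncountably many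
  points. Take two of them and a length at which they differ.\<close>

lemma uncountable_splits:
  fixes X :: "cantor set"
  assumes "uncountable {x \<in> X. seg (length s) x = s}"
  shows "\<exists>u v. take (length s) u = s \<and> take (length s) v = s \<and> length u = length v \<and> u \<noteq> v \<and>
    uncountable {x \<in> X. seg (length u) x = u} \<and> uncountable {x \<in> X. seg (length v) x = v}"
proof -
  let ?C = "\<lambda>s. {x \<in> X. seg (length s) x = s}"
  let ?B = "\<Union>u\<in>{u. countable (?C u)}. ?C u"
  have "countable ?B"
    by (intro countable_UN countableI_type) simp
  then have unc: "uncountable (?C s - ?B)"
    using assms by (rule uncountable_minus_countable[rotated])
  obtain x where x: "x \<in> ?C s - ?B"
    using uncountable_imp_nonempty[OF unc] by (rule exE)
  have unc': "uncountable (?C s - ?B - {x})"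
    by (rule uncountable_minus_countable[OF unc]) simp
  obtain y where y: "y \<in> ?C s - ?B - {x}"
    using uncountable_imp_nonempty[OF unc'] by (rule exE)
  then have "x \<noteq> y"
    by blast
  then obtain d where d: "x d \<noteq> y d"
    unfolding fun_eq_iff by blast
  define n where "n = max (length s) (Suc d)"
  have big: "uncountable (?C (seg n t))" if t: "t \<in> ?C s - ?B" for t
  proof
    assume count: "countable (?C (seg n t))"
    have "t \<in> ?C (seg n t)"
      using t by simp
    then have "t \<in> ?B"
      using count by (intro UN_I[of "seg n t"]) simp_all
    then show False
      using t by blast
  qed
  have take: "take (length s) (seg n t) = s" if "t \<in> ?C s" for t
    using that by (simp add: take_seg n_def)
  have "seg n x \<noteq> seg n y"
  proof
    assume "seg n x = seg n y"
    then have "seg (Suc d) x = seg (Suc d) y"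
      by (rule seg_eq_mono) (simp add: n_def)
    then show False
      using d unfolding seg_eq_iff by blast
  qed
  moreover have "take (length s) (seg n x) = s" "take (length s) (seg n y) = s"
    using take[OF DiffD1[OF x]] take[OF DiffD1[OF DiffD1[OF y]]] .
  moreover have "uncountable (?C (seg n x))" "uncountable (?C (seg n y))"
    using big[OF x] big[OF DiffD1[OF y]] .
  moreover have "length (seg n x) = length (seg n y)"
    by simp
  ultimately show ?thesis
    by (intro exI conjI)
qed

lemma uncountable_scheme:
  assumes "uncountable X"
  shows "\<exists>\<sigma>. splitting_scheme X \<sigma>"
proof -
  define big where "big s \<longleftrightarrow> uncountable {x \<in> X. seg (length s) x = s}" for s
  have "\<forall>s. \<exists>p. big s \<longrightarrow> take (length s) (fst p) = s \<and> take (length s) (snd p) = s \<and>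
      length (fst p) = length (snd p) \<and> fst p \<noteq> snd p \<and> big (fst p) \<and> big (snd p)"
    using uncountable_splits[of X] unfolding big_def by simp
  from choice[OF this] obtain p where p: "\<forall>s. big s \<longrightarrow> take (length s) (fst (p s)) = s \<and>
      take (length s) (snd (p s)) = s \<and> length (fst (p s)) = length (snd (p s)) \<and>
      fst (p s) \<noteq> snd (p s) \<and> big (fst (p s)) \<and> big (snd (p s))" ..
  have "big []"
    using assms by (simp add: big_def)
  moreover have "s \<in> seg (length s) ` X" if "big s" for s
  proof -
    have "{x \<in> X. seg (length s) x = s} \<noteq> {}"
      using that unfolding big_def by (metis countable_empty)
    then show ?thesis
      by force
  qed
  ultimately have "splitting_scheme X (\<lambda>s. if big s then Some (p s) else None)"
    unfolding splitting_scheme_def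
  proof (intro conjI allI impI)
    fix s u v assume "(if big s then Some (p s) else None) = Some (u, v)"
    then have s: "big s" "p s = (u, v)"
      by (simp_all split: if_splits)
    note * = p[rule_format, OF s(1), unfolded s(2) fst_conv snd_conv]
    show "s \<in> seg (length s) ` X"
      by (rule \<open>\<And>s. big s \<Longrightarrow> s \<in> seg (length s) ` X\<close>) (rule s(1))
    show "take (length s) u = s" "take (length s) v = s" "length u = length v" "u \<noteq> v"
      using * by blast+
    show "(if big u then Some (p u) else None) \<noteq> None" "(if big v then Some (p v) else None) \<noteq> None"
      using * by simp_all
  qed simp
  then show ?thesis
    by (intro exI[of "splitting_scheme X"])
qed

definition scheme_of_code :: "(nat \<Rightarrow> nat) \<Rightarrow> bool list \<Rightarrow> (bool list \<times> bool list) option" where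
  "scheme_of_code w s = from_nat (w (to_nat s))"

text \<open>A violation of the requirements on a scheme involves at most three values of \<open>\<sigma>\<close> and one
  level of \<open>X\<close>, so the set of pairs with a coded scheme is closed.\<close>

lemma analytic_in_uncountable: "analytic_in P_space {p \<in> P_set. uncountable (fst p)}"
  unfolding analytic_in_def
proof (intro exI conjI)
  let ?F = "{(p, w). p \<in> P_set \<and> splitting_scheme (fst p) (scheme_of_code w)}"
  show "closedin (prod_topology P_space euclidean) ?F"
  proof (rule closedin_P_space_times)
    fix p w assume p: "p \<in> P_set" "(p, w) \<notin> ?F"
    let ?\<sigma> = "scheme_of_code w"
    have agree: "scheme_of_code v s = ?\<sigma> s" if "seg n v = seg n w" "to_nat s < n" for v s n
      using that by (simp add: scheme_of_code_def seg_eq_iff)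
    from p consider "?\<sigma> [] = None"
      | s u v where "?\<sigma> s = Some (u, v)" "\<not> (s \<in> seg (length s) ` fst p \<and> take (length s) u = s \<and>
          take (length s) v = s \<and> length u = length v \<and> u \<noteq> v \<and> ?\<sigma> u \<noteq> None \<and> ?\<sigma> v \<noteq> None)"
      unfolding splitting_scheme_def by blast
    then show "\<exists>m n. \<forall>q\<in>P_set. \<forall>v. level m q = level m p \<and> seg n v = seg n w \<longrightarrow> (q, v) \<notin> ?F"
    proof cases
      case 1
      have "(q, v) \<notin> ?F" if "seg (Suc (to_nat ([] :: bool list))) v = seg (Suc (to_nat ([] :: bool list))) w" for q v
        using agree[OF that lessI] 1 by (simp add: splitting_scheme_def)
      then show ?thesis
        by blast
    next
      case 2
      define n where "n = Suc (max (to_nat s) (max (to_nat u) (to_nat v)))"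
      have n: "to_nat s < n" "to_nat u < n" "to_nat v < n"
        by (auto simp: n_def)
      have "(q, w') \<notin> ?F" if lev: "level (length s) q = level (length s) p" and w': "seg n w' = seg n w" for q w'
      proof
        assume "(q, w') \<in> ?F"
        then have "splitting_scheme (fst q) (scheme_of_code w')"
          by simp
        moreover have "scheme_of_code w' s = Some (u, v)"
          using agree[OF w' n(1)] 2(1) by simp
        ultimately have "s \<in> seg (length s) ` fst q" "take (length s) u = s" "take (length s) v = s"
          "length u = length v" "u \<noteq> v" "scheme_of_code w' u \<noteq> None" "scheme_of_code w' v \<noteq> None"
          by (rule splitting_schemeD)+
        moreover have "seg (length s) ` fst q = seg (length s) ` fst p"
          using lev unfolding level_eq_iff by blast
        ultimately show False
          using 2(2) agree[OF w' n(2)] agree[OF w' n(3)] by simp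
      qed
      then show ?thesis
        by blast
    qed
  qed auto
  show "{p \<in> P_set. uncountable (fst p)} = fst ` ?F"
  proof (intro subset_antisym subsetI)
    fix p assume p: "p \<in> {p \<in> P_set. uncountable (fst p)}"
    then obtain \<sigma> where \<sigma>: "splitting_scheme (fst p) \<sigma>"
      using uncountable_scheme by blast
    have "scheme_of_code (\<lambda>n. to_nat (\<sigma> (from_nat n))) = \<sigma>"
      by (rule ext) (simp add: scheme_of_code_def)
    then have "(p, \<lambda>n. to_nat (\<sigma> (from_nat n))) \<in> ?F"
      using p \<sigma> by simp
    then show "p \<in> fst ` ?F"
      by force
  next
    fix p assume "p \<in> fst ` ?F"
    then obtain w where "p \<in> P_set" "splitting_scheme (fst p) (scheme_of_code w)"
      by auto
    then show "p \<in> {p \<in> P_set. uncountable (fst p)}"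
      using scheme_uncountable P_setD(1) compact_iff_closed_cantor by blast
  qed
qed

text \<open>Outside \<open>O_countable\<close>, either \<open>X\<close> is uncountable, or one of countably many \<open>2\<close>-colourings has no
  monochromatic edge, which is a closed condition.\<close>

lemma coanalytic_in_O_countable: "coanalytic_in P_space O_countable"
  unfolding coanalytic_in_def topspace_P_space
proof
  have O2: "O_set 2 = (\<Inter>c\<in>clopen_colourings 2. monochromatic_edge c)"
    by (rule O_set_eq) simp
  have "(\<lambda>_. 0) \<in> clopen_colourings 2"
    by (simp add: clopen_colourings_def locally_constant_def)
  then have ne: "clopen_colourings 2 \<noteq> {}"
    by blast
  show "O_countable \<subseteq> P_set"
    by (auto simp: O_countable_def O_set_def)
  define c where "c = from_nat_into (clopen_colourings 2)"
  have c: "range c = clopen_colourings 2"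
    unfolding c_def by (rule range_from_nat_into[OF ne countable_clopen_colourings])
  define B where "B n = (case n of 0 \<Rightarrow> {p \<in> P_set. uncountable (fst p)}
      | Suc k \<Rightarrow> P_set - monochromatic_edge (c k))" for n
  have "analytic_in P_space (B n)" for n
  proof (cases n)
    case 0
    then show ?thesis
      by (simp add: B_def analytic_in_uncountable)
  next
    case (Suc k)
    have "c k \<in> locally_constant"
      using c by (auto simp: clopen_colourings_def)
    then have "closedin P_space (P_set - monochromatic_edge (c k))"
      using openin_monochromatic_edge[of "c k"] by (metis closedin_diff closedin_topspace topspace_P_space)
    then show ?thesis
      by (simp add: B_def Suc analytic_in_closedin)
  qed
  then have "analytic_in P_space (\<Union>n. B n)"
    by (rule analytic_in_UN)
  moreover have "P_set - O_countable = (\<Union>n. B n)"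
  proof -
    have "(\<Union>n. B n) = B 0 \<union> (\<Union>k. B (Suc k))"
    proof (intro subset_antisym subsetI)
      fix p assume "p \<in> (\<Union>n. B n)"
      then obtain n where "p \<in> B n"
        by blast
      then show "p \<in> B 0 \<union> (\<Union>k. B (Suc k))"
        by (cases n) auto
    qed auto
    also have "(\<Union>k. B (Suc k)) = (\<Union>c\<in>range c. P_set - monochromatic_edge c)"
      by (simp add: B_def)
    also have "\<dots> = P_set - O_set 2"
      unfolding c O2 using ne by blast
    finally have UN: "(\<Union>n. B n) = B 0 \<union> (P_set - O_set 2)" .
    have B0: "B 0 = {p \<in> P_set. uncountable (fst p)}"
      by (simp add: B_def)
    have OC: "O_countable = {p \<in> O_set 2. countable (fst p)}"
      by (auto simp: O_countable_def)
    show ?thesis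
      unfolding UN B0 OC by blast
  qed
  ultimately show "analytic_in P_space (P_set - O_countable)"
    by simp
qed

section \<open>Countability is hard for the co-analytic sets\<close>

text \<open>A position codes a natural number and a bit. That every letter has unboundedly many codes lets
  every word be spelt with increasing positions; the bit makes the spelling highly non-unique.\<close>

definition letter :: "nat \<Rightarrow> nat \<times> bool" where
  "letter i = from_nat (fst (prod_decode i))"

lemma letter_unbounded: "\<exists>i>b. letter i = t"
proof (intro exI conjI)
  show "b < prod_encode (to_nat t, Suc b)"
    using le_prod_encode_2[of "Suc b" "to_nat t"] by simp
  show "letter (prod_encode (to_nat t, Suc b)) = t"
    by (simp add: letter_def)
qed

text \<open>The active positions of \<open>x\<close> are those of its digits \<open>True\<close> apart from the first one and from the
  position right behind it, where \<open>flip\<close> may act.\<close>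

definition active :: "cantor \<Rightarrow> nat \<Rightarrow> bool" where
  "active x i \<longleftrightarrow> x i \<and> (\<exists>j. Suc j < i \<and> x j)"

definition word :: "nat \<Rightarrow> cantor \<Rightarrow> (nat \<times> bool) list" where
  "word m x = map letter (filter (active x) [0..<m])"

text \<open>The sequences whose active positions spell a finite or infinite path through \<open>T\<close>, bits being
  ignored.\<close>

definition coded_body :: "nat list set \<Rightarrow> cantor set" where
  "coded_body T = {x. \<forall>m. map fst (word m x) \<in> T}"

definition is_tree :: "'a list set \<Rightarrow> bool" where
  "is_tree T \<longleftrightarrow> [] \<in> T \<and> (\<forall>s\<in>T. \<forall>k. take k s \<in> T)"

lemma active_first_true:
  assumes "first_true x n"
  shows "active x i \<longleftrightarrow> x i \<and> Suc n < i"
proof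
  assume "active x i"
  then obtain j where "x i" "Suc j < i" "x j"
    unfolding active_def by blast
  moreover have "n \<le> j"
    using assms \<open>x j\<close> unfolding first_true_def by (meson not_le)
  ultimately show "x i \<and> Suc n < i"
    by simp
next
  assume "x i \<and> Suc n < i"
  then show "active x i"
    using assms unfolding active_def first_true_def by blast
qed

lemma active_flip: "active (flip \<alpha> x) = active x"
proof (cases "\<exists>n. first_true x n")
  case True
  then obtain n where n: "first_true x n" ..
  then have n': "first_true (flip \<alpha> x) n"
    by (simp add: first_true_flip)
  show ?thesis
  proof
    fix i
    show "active (flip \<alpha> x) i = active x i"
      unfolding active_first_true[OF n] active_first_true[OF n']
      using flip_other[OF n, of i \<alpha>] by (cases "i = Suc n") simp_all
  qed
next
  case False
  then have "flip \<alpha> x = x"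
    by (intro flip_inactive) blast
  then show ?thesis
    by simp
qed

lemma word_flip: "word m (flip \<alpha> x) = word m x"
  by (simp add: word_def active_flip)

lemma length_word: "length (word m x) \<le> m"
  unfolding word_def length_map by (rule order_trans[OF length_filter_le]) simp

lemma word_cong:
  assumes "seg m x = seg m y"
  shows "word m x = word m y"
proof -
  have "active x i = active y i" if "i < m" for i
  proof -
    have "x j = y j" if "j \<le> i" for j
      using assms that \<open>i < m\<close> by (simp add: seg_eq_iff)
    then show ?thesis
      unfolding active_def by (metis Suc_leD le_eq_less_or_eq)
  qed
  then have "filter (active x) [0..<m] = filter (active y) [0..<m]"
    by (intro filter_cong) auto
  then show ?thesis
    by (simp add: word_def)
qed

lemma word_prefix:
  assumes "k \<le> m"
  shows "word k x = take (length (word k x)) (word m x)"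
proof -
  have "[0..<m] = [0..<k] @ [k..<m]"
    using assms upt_add_eq_append[of 0 k "m - k"] by simp
  then show ?thesis
    by (simp add: word_def)
qed

lemma is_treeD: "is_tree T \<Longrightarrow> s \<in> T \<Longrightarrow> take k s \<in> T"
  by (simp add: is_tree_def)

lemma word_tree:
  assumes "is_tree T" "map fst (word m x) \<in> T" "k \<le> m"
  shows "map fst (word k x) \<in> T"
  using is_treeD[OF assms(1,2), of "length (word k x)"] word_prefix[OF assms(3), of x]
  by (simp only: take_map)

text \<open>An initial segment whose word lies in \<open>T\<close> is continued by \<open>False\<close>, which spells nothing more.
  So membership of a segment in level \<open>m\<close> is decided by finitely many nodes of \<open>T\<close>, and this is what makes
  the set vary continuously with the tree.\<close>

lemma seg_coded_body:
  assumes T: "is_tree T"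
  shows "seg m ` coded_body T = seg m ` {x. map fst (word m x) \<in> T}"
proof (intro subset_antisym subsetI)
  fix s assume "s \<in> seg m ` coded_body T"
  then show "s \<in> seg m ` {x. map fst (word m x) \<in> T}"
    unfolding coded_body_def by blast
next
  fix s assume "s \<in> seg m ` {x. map fst (word m x) \<in> T}"
  then obtain x where x: "map fst (word m x) \<in> T" "s = seg m x"
    by blast
  let ?x = "\<lambda>i. i < m \<and> x i"
  have seg: "seg m ?x = seg m x"
    by (simp add: seg_eq_iff)
  then have word: "map fst (word m ?x) \<in> T"
    using x(1) word_cong[OF seg] by simp
  have "map fst (word k ?x) \<in> T" for k
  proof (cases "k \<le> m")
    case True
    then show ?thesis
      by (rule word_tree[OF T word])
  next
    case False
    then have "[0..<k] = [0..<m] @ [m..<k]"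
      using upt_add_eq_append[of 0 m "k - m"] by simp
    moreover have "filter (active ?x) [m..<k] = []"
      by (simp add: active_def)
    ultimately have "word k ?x = word m ?x"
      by (simp add: word_def)
    then show ?thesis
      using word by simp
  qed
  then have "?x \<in> coded_body T"
    by (simp add: coded_body_def)
  then show "s \<in> seg m ` coded_body T"
    using seg x(2) by (metis image_eqI)
qed

lemma closed_coded_body: "closed (coded_body T)"
proof -
  have "map fst (word m x) \<in> T \<longleftrightarrow> seg m x \<in> seg m ` {x. map fst (word m x) \<in> T}" for m x
  proof
    assume "seg m x \<in> seg m ` {x. map fst (word m x) \<in> T}"
    then obtain y where "map fst (word m y) \<in> T" "seg m x = seg m y"
      by blast
    then show "map fst (word m x) \<in> T"
      using word_cong[of m x y] by simp
  qed simp
  then have "coded_body T = {x. \<forall>m. seg m x \<in> seg m ` {x. map fst (word m x) \<in> T}}"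
    unfolding coded_body_def by blast
  then show ?thesis
    using closed_levels[of "\<lambda>m. seg m ` {x. map fst (word m x) \<in> T}"] by (simp only:)
qed

text \<open>These points have no active position. They provide the short edges of \<open>flip\<close>.\<close>

lemma singleton_in_coded_body:
  assumes "is_tree T"
  shows "(\<lambda>k. k = i) \<in> coded_body T"
proof -
  have "\<not> active (\<lambda>k. k = i) l" for l
    by (auto simp: active_def)
  then show ?thesis
    using assms by (simp add: coded_body_def word_def is_tree_def)
qed

lemma flip_coded_body: "flip \<alpha> ` coded_body T = coded_body T"
proof -
  have maps: "flip \<alpha> x \<in> coded_body T" if "x \<in> coded_body T" for x
    using that by (simp add: coded_body_def word_flip)
  have "x \<in> flip \<alpha> ` coded_body T" if "x \<in> coded_body T" for x
    by (rule image_eqI[of _ _ "flip \<alpha> x"]) (simp_all add: flip_flip maps that)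
  then show ?thesis
    using maps by blast
qed

lemma coded_body_in_P_set: "(coded_body T, flip \<alpha>) \<in> P_set"
  unfolding P_set_def
  by (simp add: compact_iff_closed_cantor closed_coded_body flip_homeo flip_coded_body)

lemma word_strict_mono:
  assumes p: "strict_mono p" "range p = Collect (active x)"
  shows "word (p n) x = seg n (letter \<circ> p)"
proof -
  have "filter (active x) [0..<p n] = map p [0..<n]"
  proof (rule sorted_distinct_set_unique)
    show "sorted (map p [0..<n])" "distinct (map p [0..<n])"
      using p(1) by (auto simp: sorted_map distinct_map strict_mono_less_eq sorted_wrt_iff_nth_less
          intro: strict_mono_imp_inj_on inj_on_subset)
    have "active x i \<longleftrightarrow> i \<in> range p" for i
      using p(2) by blast
    then show "set (filter (active x) [0..<p n]) = set (map p [0..<n])"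
      using strict_mono_less[OF p(1)] by auto
  qed (simp_all add: sorted_wrt_filter)
  then show ?thesis
    by (simp add: word_def seg_def)
qed

lemma coded_body_branch_iff:
  assumes T: "is_tree T" and p: "strict_mono p" "range p = Collect (active x)"
  shows "x \<in> coded_body T \<longleftrightarrow> (\<forall>n. seg n (fst \<circ> letter \<circ> p) \<in> T)"
proof -
  have eq: "map fst (word (p n) x) = seg n (fst \<circ> letter \<circ> p)" for n
    unfolding word_strict_mono[OF p] by (simp add: seg_def)
  show ?thesis
  proof
    assume "x \<in> coded_body T"
    then have "map fst (word (p n) x) \<in> T" for n
      by (simp add: coded_body_def)
    then show "\<forall>n. seg n (fst \<circ> letter \<circ> p) \<in> T"
      unfolding eq by blast
  next
    assume *: "\<forall>n. seg n (fst \<circ> letter \<circ> p) \<in> T"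
    have "map fst (word m x) \<in> T" for m
    proof (rule word_tree[OF T])
      show "map fst (word (p m) x) \<in> T"
        unfolding eq using * by blast
      show "m \<le> p m"
        using p(1) by (rule strict_mono_imp_increasing)
    qed
    then show "x \<in> coded_body T"
      by (simp add: coded_body_def)
  qed
qed

text \<open>Infinitely many active positions would spell a branch, so all points have finite support.\<close>

lemma countable_coded_body:
  assumes T: "is_tree T" and no_branch: "\<And>w. \<exists>n. seg n w \<notin> T"
  shows "countable (coded_body T)"
proof -
  have "finite {i. x i}" if x: "x \<in> coded_body T" for x
  proof (cases "\<exists>n. first_true x n")
    case True
    then obtain n where n: "first_true x n" ..
    have "finite (Collect (active x))"
    proof (rule ccontr)
      assume inf: "infinite (Collect (active x))"
      let ?p = "enumerate (Collect (active x))"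
      have p: "strict_mono ?p" "range ?p = Collect (active x)"
        using strict_mono_enumerate[OF inf] range_enumerate[OF inf] by simp_all
      show False
        using x no_branch[of "fst \<circ> letter \<circ> ?p"] unfolding coded_body_branch_iff[OF T p] by blast
    qed
    moreover have "{i. x i} \<subseteq> Collect (active x) \<union> {..Suc n}"
      unfolding active_first_true[OF n] by auto
    ultimately show ?thesis
      by (meson finite_UnI finite_atMost finite_subset)
  next
    case False
    have "{i. x i} = {}"
    proof (rule ccontr)
      assume "{i. x i} \<noteq> {}"
      then have ex: "\<exists>i. x i"
        by blast
      have "first_true x (LEAST i. x i)"
        unfolding first_true_def using LeastI_ex[OF ex] not_less_Least by blast
      then show False
        using False by blast
    qed
    then show ?thesis
      by simp
  qed
  then have "coded_body T \<subseteq> (\<lambda>A i. i \<in> A) ` Collect finite"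
    by (intro subsetI) (rule image_eqI[of _ _ "Collect _"], auto)
  then show ?thesis
    by (rule countable_subset) (intro countable_image countable_Collect_finite)
qed

text \<open>For each \<open>y\<close> the branch is spelt with increasing positions whose bits are \<open>y\<close>. The spelt word with
  its bits recovers \<open>y\<close> from the point, so that distinct \<open>y\<close> give distinct points.\<close>

lemma uncountable_coded_body:
  assumes T: "is_tree T" and branch: "\<And>n. seg n w \<in> T"
  shows "uncountable (coded_body T)"
proof -
  have "\<exists>x p. strict_mono p \<and> range p = Collect (active x) \<and> (\<forall>n. letter (p n) = (w n, y n))" for y
  proof -
    have "\<exists>p. \<forall>n. (1 < p n \<and> letter (p n) = (w n, y n)) \<and> p n < p (Suc n)"
      by (rule dependent_nat_choice) (use letter_unbounded in \<open>blast, meson less_trans letter_unbounded\<close>)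
    then obtain p where p: "\<And>n. 1 < p n" "\<And>n. letter (p n) = (w n, y n)" "\<And>n. p n < p (Suc n)"
      by blast
    \<comment> \<open>The digit at \<open>0\<close> is the first \<open>True\<close>; it makes exactly the positions in the range of \<open>p\<close> active.\<close>
    let ?x = "\<lambda>i. i = 0 \<or> i \<in> range p"
    have "active ?x i \<longleftrightarrow> i \<in> range p" for i
    proof
      assume "active ?x i"
      then show "i \<in> range p"
        by (auto simp: active_def)
    next
      assume "i \<in> range p"
      then have "Suc 0 < i"
        using p(1) by auto
      then show "active ?x i"
        using \<open>i \<in> range p\<close> by (auto simp: active_def intro: exI[of _ 0])
    qed
    then have "range p = Collect (active ?x)"
      by blast
    moreover have "strict_mono p"
      using p(3) by (simp add: strict_mono_Suc_iff)
    ultimately show ?thesis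
      using p(2) by blast
  qed
  then have "\<forall>y. \<exists>x p. strict_mono p \<and> range p = Collect (active x) \<and> (\<forall>n. letter (p n) = (w n, y n))"
    by blast
  from choice[OF this] obtain X where
    "\<forall>y. \<exists>p. strict_mono p \<and> range p = Collect (active (X y)) \<and> (\<forall>n. letter (p n) = (w n, y n))" ..
  from choice[OF this] obtain p where
    p: "\<forall>y. strict_mono (p y) \<and> range (p y) = Collect (active (X y)) \<and> (\<forall>n. letter (p y n) = (w n, y n))" ..
  have word: "word (p y n) (X y) = seg n (\<lambda>k. (w k, y k))" for y n
  proof -
    have "letter \<circ> p y = (\<lambda>k. (w k, y k))"
      using p by auto
    then show ?thesis
      using word_strict_mono[of "p y" "X y" n] p by simp
  qed
  have "X y \<in> coded_body T" for y
  proof -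
    have "fst \<circ> letter \<circ> p y = w"
      using p by (simp add: fun_eq_iff)
    then show ?thesis
      using coded_body_branch_iff[OF T, of "p y" "X y"] p branch by simp
  qed
  moreover have "inj X"
  proof (rule injI, rule ext_seg)
    fix y y' :: cantor and n
    assume eq: "X y = X y'"
    let ?m = "max (p y n) (p y' n)"
    \<comment> \<open>At the common position \<open>?m\<close>, both sequences can be read off from the same word.\<close>
    have "seg n (\<lambda>k. (w k, y k)) = take n (word ?m (X y))"
      using word_prefix[of "p y n" ?m "X y"] word[of y n] by simp
    moreover have "seg n (\<lambda>k. (w k, y' k)) = take n (word ?m (X y))"
      using word_prefix[of "p y' n" ?m "X y'"] word[of y' n] eq by simp
    ultimately have "seg n (\<lambda>k. (w k, y k)) = seg n (\<lambda>k. (w k, y' k))"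
      by simp
    then show "seg n y = seg n y'"
      by (simp add: seg_eq_iff)
  qed
  ultimately show ?thesis
    using uncountable_cantor by (metis countable_image_inj_on countable_subset image_subset_iff)
qed

text \<open>For each finite sequence \<open>s\<close>, the largest open set \<open>W s\<close> whose product with the cylinder of \<open>s\<close>
  misses \<open>F\<close> is a countable union of clopen sets. This gives countably many rectangles \<open>V i\<close> times
  the cylinder of \<open>S i\<close>, which together cover the complement of \<open>F\<close>.\<close>

lemma closedin_times_baire:
  fixes F :: "('z \<times> (nat \<Rightarrow> nat)) set"
  assumes Z: "polish Z" "zero_dimensional Z" and F: "closedin (prod_topology Z euclidean) F"
  shows "\<exists>V S. (\<forall>i::nat. clopen_in Z (V i)) \<and>
    (\<forall>z\<in>topspace Z. \<forall>w. (z, w) \<in> F \<longleftrightarrow> (\<forall>i. \<not> (z \<in> V i \<and> seg (length (S i)) w = S i)))"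
proof -
  define W where "W s = \<Union>{U. openin Z U \<and> U \<times> {w. seg (length s) w = s} \<inter> F = {}}" for s :: "nat list"
  have "openin Z (W s)" for s
    unfolding W_def by (rule openin_Union) blast
  then have "\<forall>s. \<exists>V :: nat \<Rightarrow> _. (\<forall>i. clopen_in Z (V i)) \<and> (\<Union>i. V i) = W s"
    using openin_countable_Union_clopen[OF Z] by blast
  from choice[OF this] obtain V where V: "\<forall>s. (\<forall>i::nat. clopen_in Z (V s i)) \<and> (\<Union>i. V s i) = W s" ..
  define S where "S i = (from_nat (fst (prod_decode i)) :: nat list)" for i
  define V' where "V' i = V (S i) (snd (prod_decode i))" for i
  have "(z, w) \<in> F \<longleftrightarrow> (\<forall>i. \<not> (z \<in> V' i \<and> seg (length (S i)) w = S i))" if z: "z \<in> topspace Z" for z w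
  proof (intro iffI allI notI)
    fix i assume "(z, w) \<in> F" "z \<in> V' i \<and> seg (length (S i)) w = S i"
    moreover from this have "z \<in> W (S i)"
      using V unfolding V'_def by blast
    ultimately show False
      unfolding W_def by blast
  next
    assume *: "\<forall>i. \<not> (z \<in> V' i \<and> seg (length (S i)) w = S i)"
    show "(z, w) \<in> F"
    proof (rule ccontr)
      assume "(z, w) \<notin> F"
      then have mem: "(z, w) \<in> topspace (prod_topology Z euclidean) - F"
        using z by simp
      have "openin (prod_topology Z euclidean) (topspace (prod_topology Z euclidean) - F)"
        using F by blast
      from this[unfolded openin_prod_topology_alt, rule_format, OF mem]
      obtain U B where UB: "openin Z U" "openin euclidean B" "z \<in> U" "w \<in> B"
          "U \<times> B \<subseteq> topspace (prod_topology Z euclidean) - F"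
        by (elim exE conjE)
      have "open B"
        using UB(2) by simp
      then obtain n where n: "\<forall>v. seg n v = seg n w \<longrightarrow> v \<in> B"
        using UB(4) unfolding open_iff_seg by blast
      have "U \<times> {v. seg (length (seg n w)) v = seg n w} \<inter> F = {}"
        using n UB(5) unfolding length_seg by blast
      then have "z \<in> W (seg n w)"
        using UB(1,3) unfolding W_def by blast
      then obtain j where j: "z \<in> V (seg n w) j"
        using V by blast
      let ?i = "prod_encode (to_nat (seg n w), j)"
      have "S ?i = seg n w" "z \<in> V' ?i"
        using j by (simp_all add: S_def V'_def)
      then show False
        using * by (metis length_seg)
    qed
  qed
  moreover have "clopen_in Z (V' i)" for i
    using V unfolding V'_def by blast
  ultimately show ?thesis
    by (intro exI[of _ V'] exI[of _ S]) blast
qed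

text \<open>In the node \<open>s\<close> only the first \<open>length s\<close> rectangles are taken into account, so that \<open>s\<close> being a
  node is a clopen condition on \<open>z\<close>. Since every rectangle is considered eventually, the branches are
  the points of the section at \<open>z\<close>.\<close>

definition section_tree :: "(nat \<Rightarrow> 'z set) \<Rightarrow> (nat \<Rightarrow> nat list) \<Rightarrow> 'z \<Rightarrow> nat list set" where
  "section_tree V S z = {s. \<forall>i<length s. \<not> (z \<in> V i \<and> take (length (S i)) s = S i)}"

lemma is_tree_section_tree: "is_tree (section_tree V S z)"
  unfolding is_tree_def section_tree_def
proof (intro conjI ballI allI CollectI impI notI)
  fix s k i
  assume s: "s \<in> {s. \<forall>i<length s. \<not> (z \<in> V i \<and> take (length (S i)) s = S i)}"
    and i: "i < length (take k s)" and z: "z \<in> V i \<and> take (length (S i)) (take k s) = S i"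
  have "take (min (length (S i)) k) s = S i"
    using z by simp
  then have "take (length (S i)) s = S i"
    by (metis length_take min.cobounded1 min_def nle_le take_all_iff)
  then show False
    using s i z by simp
qed simp

lemma section_tree_branch_iff:
  "(\<forall>n. seg n w \<in> section_tree V S z) \<longleftrightarrow> (\<forall>i. \<not> (z \<in> V i \<and> seg (length (S i)) w = S i))"
proof (intro iffI allI notI)
  fix i assume *: "\<forall>n. seg n w \<in> section_tree V S z" and i: "z \<in> V i \<and> seg (length (S i)) w = S i"
  let ?n = "max (Suc i) (length (S i))"
  have "seg ?n w \<in> section_tree V S z"
    using * by blast
  moreover have "take (length (S i)) (seg ?n w) = S i"
    using i by (simp add: take_seg)
  ultimately show False
    using i by (simp add: section_tree_def)
next
  fix n assume *: "\<forall>i. \<not> (z \<in> V i \<and> seg (length (S i)) w = S i)"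
  have "seg (length (S i)) w = S i" if "take (length (S i)) (seg n w) = S i" for i
  proof -
    have "length (S i) \<le> n"
      using arg_cong[OF that, of length] by simp
    then show ?thesis
      using that by (simp add: take_seg)
  qed
  then show "seg n w \<in> section_tree V S z"
    using * unfolding section_tree_def by blast
qed

theorem Pi11_complete_O_countable: "Pi11_complete TYPE('z) P_space O_countable"
  unfolding Pi11_complete_def class_complete_def
proof (intro conjI allI impI coanalytic_in_O_countable)
  fix Z :: "'z topology" and C
  assume Z: "polish Z \<and> zero_dimensional Z \<and> coanalytic_in Z C"
  then obtain F where F: "closedin (prod_topology Z (euclidean :: (nat \<Rightarrow> nat) topology)) F"
      "topspace Z - C = fst ` F" "C \<subseteq> topspace Z"
    unfolding coanalytic_in_def analytic_in_def by blast
  obtain V S where V: "\<forall>i::nat. clopen_in Z (V i)"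
    and VS: "\<forall>z\<in>topspace Z. \<forall>w. (z, w) \<in> F \<longleftrightarrow> (\<forall>i. \<not> (z \<in> V i \<and> seg (length (S i)) w = S i))"
    using closedin_times_baire[OF _ _ F(1)] Z by blast
  let ?T = "section_tree V S"
  let ?G = "\<lambda>z. (coded_body (?T z), flip (\<lambda>_. True))"
  have "continuous_map Z P_space ?G"
  proof (rule continuous_into_P_space)
    show "clopen_in Z (V i)" for i
      using V by blast
    show "?G z \<in> P_set" for z
      by (rule coded_body_in_P_set)
    fix m z z' assume eq: "\<forall>i<m. z \<in> V i \<longleftrightarrow> z' \<in> V i"
    have "map fst (word m x) \<in> ?T z \<longleftrightarrow> map fst (word m x) \<in> ?T z'" for x
      using eq length_word[of m x] by (auto simp: section_tree_def)
    then have "seg m ` coded_body (?T z) = seg m ` coded_body (?T z')"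
      unfolding seg_coded_body[OF is_tree_section_tree] by simp
    then show "level m (?G z) = level m (?G z')"
      by (simp add: level_eq_iff)
  qed
  moreover have "z \<in> C \<longleftrightarrow> ?G z \<in> O_countable" if z: "z \<in> topspace Z" for z
  proof -
    have "?G z \<in> O_set 2"
      by (intro flip_in_O_set coded_body_in_P_set singleton_in_coded_body is_tree_section_tree)
        simp_all
    moreover have "countable (coded_body (?T z)) \<longleftrightarrow> \<not> (\<exists>w. \<forall>n. seg n w \<in> ?T z)"
      using countable_coded_body[OF is_tree_section_tree] uncountable_coded_body[OF is_tree_section_tree]
      by metis
    moreover have "(\<exists>w. \<forall>n. seg n w \<in> ?T z) \<longleftrightarrow> z \<in> fst ` F"
      unfolding section_tree_branch_iff using VS z by force
    ultimately show ?thesis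
      using F(2) z by (auto simp: O_countable_def)
  qed
  then have "C = {z \<in> topspace Z. ?G z \<in> O_countable}"
    using F(3) by blast
  ultimately show "\<exists>f. continuous_map Z P_space f \<and> C = {z \<in> topspace Z. f z \<in> O_countable}"
    by (intro exI conjI)
qed

theorem theorem1p12:
  shows "polish P_space \<and>
    clopen_in P_space (O_set 0) \<and>
    Sigma01_complete TYPE('z) P_space (O_set 1) \<and>
    Pi02_complete TYPE('z) P_space (O_set 2) \<and>
    Pi02_complete TYPE('z) P_space (O_set 3) \<and>
    Pi11_complete TYPE('z) P_space O_countable"
  by (intro conjI polish_P_space clopen_O_set_0 Sigma01_complete_O_set_1 Pi02_complete_O_set
      Pi11_complete_O_countable) simp_all

end
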